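(* Let $\mathcal H=(\mathbb C\langle\Sigma\rangle,\cdot,\Delta)$ be a connected cocommutative graded Hopf algebra whose underlying algebra is the free associative algebra on a graded alphabet $\Sigma=\bigcup_{n\ge1}\Sigma_n$ with finite graded components $\Sigma_n$. Let $\Sigma'\subset\Sigma$ be a subalphabet such that $\mathbb C\langle\Sigma'\rangle$ is compatible with the coproduct $\Delta$, in the sense that the restriction of $\Delta$ to $\Sigma'$ maps into $\mathbb C\langle\Sigma'\rangle\otimes\mathbb C\langle\Sigma'\rangle$. Then the bialgebra $(\mathbb C\langle\Sigma'\rangle,\Cup,\Delta_\cdot)$ is a Hopf algebra which is isomorphic to the dual of the bialgebra $(\mathbb C\langle\Sigma'\rangle,\cdot,\Delta)$, and for any $u_1,u_2\in{\Sigma'}^*$ such that $u_1\ne1$ or $u_2\neq 1$ we have $$u_1\Cup u_2=\sum_{\substack{u_1=p_1v_1,\ u_2=p_2v_2\\ p_1\ne1\ \text{or}\ p_2\neq1}}\ \sum_{a\in\Sigma'}(p_1\otimes p_2,\Delta(a))\,a\cdot(v_1\Cup v_2).$$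
   Context: $\Sigma^*$ (resp. ${\Sigma'}^*$) is the free monoid of words on $\Sigma$ (resp. $\Sigma'$), with empty word $1$; $\cdot$ is concatenation, and $\mathbb C\langle\Sigma\rangle$ is graded by giving letters of $\Sigma_n$ degree $n$; $\Delta$ is an algebra morphism compatible with this grading, so the graded components are finite dimensional and the component of degree $0$ is $\mathbb C$. Dual means graded dual. The bilinear pairing on $\mathbb C\langle\Sigma\rangle$ is defined on words by $(u_1,u_2)=1$ if $u_1=u_2$ and $0$ otherwise, and is extended to $\mathbb C\langle\Sigma\rangle\otimes\mathbb C\langle\Sigma\rangle$ by $(u_1\otimes u_2,w_1\otimes w_2)=(u_1,w_1)(u_2,w_2)$. The product $\Cup$ on $\mathbb C\langle\Sigma\rangle$ is characterized by $(u_1\Cup u_2,w)=(u_1\otimes u_2,\Delta(w))$ for all words $u_1,u_2,w\in\Sigma^*$. The coproduct $\Delta_\cdot$ is deconcatenation: $\Delta_\cdot(w)=\sum_{w=u_1u_2}u_1\otimes u_2$ for each word $w$. In $(\mathbb C\langle\Sigma'\rangle,\Cup,\Delta_\cdot)$ and $(\mathbb C\langle\Sigma'\rangle,\cdot,\Delta)$ the operations are the restrictions to $\mathbb C\langle\Sigma'\rangle$ of those on $\mathbb C\langle\Sigma\rangle$. In the displayed formula the outer sum runs over all factorizations of the words $u_1$ and $u_2$ into a prefix $p_i$ and a suffix $v_i$ with $(p_1,p_2)\ne(1,1)$.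
   Formalization: The product ⋓ on C⟨Σ'⟩ is taken as the product dual to the restricted Δ (words outside Σ'* are discarded), since the literal restriction of ⋓ from C⟨Σ⟩ need not stay in C⟨Σ'⟩; the two agree whenever it does. *)

theory Defs
  imports Complex_Main "HOL-Library.Function_Algebras"
begin

section \<open>Complex vector spaces of functions and their tensor products\<close>

text \<open>
  All vector spaces are linear subspaces of spaces of functions \<open>'x \<Rightarrow> complex\<close>. Both
  \<open>\<complex>\<langle>\<Sigma>\<rangle>\<close> (functions on words) and its graded dual (functions on \<open>\<complex>\<langle>\<Sigma>\<rangle>\<close>) are of this form.
\<close>

definition cscale :: "complex \<Rightarrow> ('x \<Rightarrow> complex) \<Rightarrow> 'x \<Rightarrow> complex" where
  "cscale c f = (\<lambda>x. c * f x)"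

interpretation cfun: vector_space cscale
  by unfold_locales (auto simp: cscale_def fun_eq_iff algebra_simps)

text \<open>Linearity on a subspace \<open>V\<close>; \<open>s\<close> is the scalar multiplication of the target.\<close>

definition linear_on ::
  "('x \<Rightarrow> complex) set \<Rightarrow> (complex \<Rightarrow> 'v \<Rightarrow> 'v) \<Rightarrow> (('x \<Rightarrow> complex) \<Rightarrow> 'v::ab_group_add) \<Rightarrow> bool" where
  "linear_on V s F \<longleftrightarrow>
     (\<forall>f\<in>V. \<forall>g\<in>V. F (f + g) = F f + F g) \<and> (\<forall>c. \<forall>f\<in>V. F (cscale c f) = s c (F f))"

definition bilinear_on ::
  "('x \<Rightarrow> complex) set \<Rightarrow> ('y \<Rightarrow> complex) set \<Rightarrow> (complex \<Rightarrow> 'v \<Rightarrow> 'v) \<Rightarrow>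
   (('x \<Rightarrow> complex) \<Rightarrow> ('y \<Rightarrow> complex) \<Rightarrow> 'v::ab_group_add) \<Rightarrow> bool" where
  "bilinear_on V W s B \<longleftrightarrow>
     (\<forall>g\<in>W. linear_on V s (\<lambda>f. B f g)) \<and> (\<forall>f\<in>V. linear_on W s (B f))"

text \<open>
  For subspaces \<open>V\<close> of \<open>'x \<Rightarrow> complex\<close> and \<open>W\<close> of \<open>'y \<Rightarrow> complex\<close>, the canonical map from the
  algebraic tensor product to the functions on \<open>'x \<times> 'y\<close> is injective, and \<open>tensor_space V W\<close>
  is its image; that it has the universal property is shown in \<open>tensor_lift\<close> below.
\<close>

definition tens :: "('x \<Rightarrow> complex) \<Rightarrow> ('y \<Rightarrow> complex) \<Rightarrow> 'x \<times> 'y \<Rightarrow> complex" where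
  "tens f g = (\<lambda>(x, y). f x * g y)"

definition tensor_space ::
  "('x \<Rightarrow> complex) set \<Rightarrow> ('y \<Rightarrow> complex) set \<Rightarrow> ('x \<times> 'y \<Rightarrow> complex) set" where
  "tensor_space V W = cfun.span {tens f g | f g. f \<in> V \<and> g \<in> W}"

text \<open>The linear map on \<open>tensor_space V W\<close> induced by a bilinear map \<open>B\<close>.\<close>

definition tensor_lift ::
  "(complex \<Rightarrow> 'v \<Rightarrow> 'v) \<Rightarrow> ('x \<Rightarrow> complex) set \<Rightarrow> ('y \<Rightarrow> complex) set \<Rightarrow>
   (('x \<Rightarrow> complex) \<Rightarrow> ('y \<Rightarrow> complex) \<Rightarrow> 'v) \<Rightarrow> ('x \<times> 'y \<Rightarrow> complex) \<Rightarrow> 'v::ab_group_add" where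
  "tensor_lift s V W B =
     (SOME F. linear_on (tensor_space V W) s F \<and> (\<forall>f\<in>V. \<forall>g\<in>W. F (tens f g) = B f g))"

lemma independent_tens:
  fixes P :: "('x \<Rightarrow> complex) set" and Q :: "('y \<Rightarrow> complex) set"
  assumes P: "cfun.independent P" and Q: "cfun.independent Q"
  shows "inj_on (\<lambda>(p, q). tens p q) (P \<times> Q)"
    and "cfun.independent ((\<lambda>(p, q). tens p q) ` (P \<times> Q))"
proof -
  have key: "u (p0, q0) = 0"
    if fin: "finite S" "S \<subseteq> P \<times> Q" and mem: "(p0, q0) \<in> S"
      and z: "(\<Sum>(p, q)\<in>S. cscale (u (p, q)) (tens p q)) = 0" for u S p0 q0
  proof -
    define A where "A = fst ` S"
    define C where "C = snd ` S"
    define w where "w pq = (if pq \<in> S then u pq else 0)" for pq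
    have AC: "finite A" "finite C" "A \<subseteq> P" "C \<subseteq> Q" "S \<subseteq> A \<times> C" "p0 \<in> A" "q0 \<in> C"
      using fin mem by (force simp: A_def C_def)+
    have "(\<Sum>p\<in>A. \<Sum>q\<in>C. cscale (w (p, q)) (tens p q))
          = (\<Sum>pq\<in>A \<times> C. cscale (w pq) (tens (fst pq) (snd pq)))"
      by (simp add: sum.cartesian_product case_prod_beta)
    also have "\<dots> = (\<Sum>pq\<in>S. cscale (w pq) (tens (fst pq) (snd pq)))"
      by (rule sum.mono_neutral_right) (use AC in \<open>auto simp: w_def\<close>)
    also have "\<dots> = (\<Sum>(p, q)\<in>S. cscale (u (p, q)) (tens p q))"
      by (rule sum.cong) (auto simp: w_def)
    finally have z': "(\<Sum>p\<in>A. \<Sum>q\<in>C. cscale (w (p, q)) (tens p q)) = 0"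
      using z by simp
    have app: "(sum h I) x = (\<Sum>i\<in>I. h i x)"
      for h :: "'i \<Rightarrow> 'z \<Rightarrow> complex" and I x
      by (induction I rule: infinite_finite_induct) auto
    have 1: "(\<Sum>q\<in>C. w (p0, q) * q y) = 0" for y
    proof -
      have "(\<Sum>p\<in>A. cscale (\<Sum>q\<in>C. w (p, q) * q y) p) = 0"
      proof
        fix x
        have "(\<Sum>p\<in>A. \<Sum>q\<in>C. cscale (w (p, q)) (tens p q)) (x, y) = 0"
          using z' by simp
        then show "(\<Sum>p\<in>A. cscale (\<Sum>q\<in>C. w (p, q) * q y) p) x = 0 x"
          by (simp add: app cscale_def tens_def sum_distrib_right sum_distrib_left mult_ac)
      qed
      from cfun.independentD[OF P AC(1) AC(3) this AC(6)] show ?thesis .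
    qed
    have "(\<Sum>q\<in>C. cscale (w (p0, q)) q) = 0"
      using 1 by (auto simp: app cscale_def fun_eq_iff)
    from cfun.independentD[OF Q AC(2) AC(4) this AC(7)] show ?thesis
      using mem by (simp add: w_def)
  qed
  show inj: "inj_on (\<lambda>(p, q). tens p q) (P \<times> Q)"
  proof (rule inj_onI, clarify, rule ccontr)
    fix p q p' q'
    assume m: "p \<in> P" "q \<in> Q" "p' \<in> P" "q' \<in> Q" and eq: "tens p q = tens p' q'"
      and ne: "\<not> (p = p' \<and> q = q')"
    have "(if (p, q) = (p, q) then 1 else - 1 :: complex) = 0"
      by (rule key[of "{(p, q), (p', q')}" p q "\<lambda>r. if r = (p, q) then 1 else - 1"])
         (use m eq ne in \<open>auto simp: cscale_def fun_eq_iff\<close>)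
    then show False by simp
  qed
  show "cfun.independent ((\<lambda>(p, q). tens p q) ` (P \<times> Q))"
    unfolding cfun.independent_explicit_module
  proof (intro allI impI)
    fix t u v
    assume t: "finite t" "t \<subseteq> (\<lambda>(p, q). tens p q) ` (P \<times> Q)"
      "(\<Sum>v\<in>t. cscale (u v) v) = 0" "v \<in> t"
    from t(2) obtain S where S: "S \<subseteq> P \<times> Q" "t = (\<lambda>(p, q). tens p q) ` S"
      by (auto simp: subset_image_iff)
    have inj': "inj_on (\<lambda>(p, q). tens p q) S"
      using inj S(1) by (rule inj_on_subset)
    have finS: "finite S" using t(1) S(2) inj' by (simp add: finite_image_iff)
    obtain p q where pq: "(p, q) \<in> S" "v = tens p q" using t(4) S(2) by auto
    have "(\<lambda>(p, q). u (tens p q)) (p, q) = 0"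
      by (rule key[OF finS S(1) pq(1)])
         (use t(3) sum.reindex[OF inj', of "\<lambda>v. cscale (u v) v"] in
          \<open>simp add: S(2) case_prod_beta comp_def\<close>)
    then show "u v = 0" using pq by simp
  qed
qed

lemma linear_on_sum:
  assumes "linear_on V s F" "cfun.subspace V" "\<And>i. i \<in> I \<Longrightarrow> h i \<in> V" "vector_space s"
  shows "F (sum h I) = (\<Sum>i\<in>I. F (h i))"
proof -
  interpret t: vector_space s by fact
  have z: "F 0 = 0"
  proof -
    have "F (cscale 0 0) = s 0 (F 0)"
      using assms(1,2) cfun.subspace_0 unfolding linear_on_def by blast
    then show ?thesis by simp
  qed
  show ?thesis
    using assms(3)
  proof (induction I rule: infinite_finite_induct)
    case (insert i I)
    then have "h i \<in> V" "sum h I \<in> V" by (auto intro: cfun.subspace_sum assms(2))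
    then have "F (h i + sum h I) = F (h i) + F (sum h I)"
      using assms(1) unfolding linear_on_def by blast
    moreover have "F (sum h I) = (\<Sum>i\<in>I. F (h i))" using insert by blast
    ultimately show ?case
      by (metis insert.hyps sum.insert)
  qed (auto simp: z)
qed

lemma bilinear_on_eq_on_span:
  assumes s: "vector_space s"
    and V: "cfun.subspace V" "P \<subseteq> V" "V \<subseteq> cfun.span P"
    and W: "cfun.subspace W" "Q \<subseteq> W" "W \<subseteq> cfun.span Q"
    and B: "bilinear_on V W s B" "bilinear_on V W s B'"
    and eq: "\<And>p q. p \<in> P \<Longrightarrow> q \<in> Q \<Longrightarrow> B p q = B' p q"
    and "f \<in> V" "g \<in> W"
  shows "B f g = B' f g"
proof -
  have *: "F x = F' x"
    if "linear_on U s F" "linear_on U s F'" "cfun.subspace U" "R \<subseteq> U"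
      "\<And>r. r \<in> R \<Longrightarrow> F r = F' r" "x \<in> cfun.span R"
    for U :: "('z \<Rightarrow> complex) set" and R F F' x
  proof -
    from that(6) obtain t r where x: "finite t" "t \<subseteq> R" "x = (\<Sum>a\<in>t. cscale (r a) a)"
      by (auto simp: cfun.span_explicit)
    have "F x = (\<Sum>a\<in>t. F (cscale (r a) a))" unfolding x(3)
      by (rule linear_on_sum[OF that(1,3) _ s]) (use x that in \<open>auto intro: cfun.subspace_scale\<close>)
    also have "\<dots> = (\<Sum>a\<in>t. F' (cscale (r a) a))"
    proof (rule sum.cong[OF refl])
      fix a assume "a \<in> t"
      then have "a \<in> U" "F a = F' a" using x that by auto
      then show "F (cscale (r a) a) = F' (cscale (r a) a)"
        using that(1,2) by (simp add: linear_on_def)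
    qed
    also have "\<dots> = F' x" unfolding x(3)
      by (rule linear_on_sum[OF that(2,3) _ s, symmetric])
         (use x that in \<open>auto intro: cfun.subspace_scale\<close>)
    finally show ?thesis .
  qed
  have "B p g = B' p g" if "p \<in> P" for p
    using that V W B eq \<open>g \<in> W\<close> unfolding bilinear_on_def
    by (intro *[of W "B p" "B' p" Q g]) blast+
  then show ?thesis
    using V W B \<open>f \<in> V\<close> \<open>g \<in> W\<close> unfolding bilinear_on_def
    by (intro *[of V "\<lambda>f. B f g" "\<lambda>f. B' f g" P f]) blast+
qed

lemma tensor_lift:
  fixes V :: "('x \<Rightarrow> complex) set" and W :: "('y \<Rightarrow> complex) set"
  assumes s: "vector_space s" and V: "cfun.subspace V" and W: "cfun.subspace W"
    and B: "bilinear_on V W s B"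
  shows "linear_on (tensor_space V W) s (tensor_lift s V W B)"
    and "\<And>f g. f \<in> V \<Longrightarrow> g \<in> W \<Longrightarrow> tensor_lift s V W B (tens f g) = B f g"
proof -
  interpret t: vector_space s by fact
  interpret vector_space_pair cscale s ..
  obtain P where P: "P \<subseteq> V" "cfun.independent P" "V \<subseteq> cfun.span P"
    by (rule cfun.basis_exists)
  obtain Q where Q: "Q \<subseteq> W" "cfun.independent Q" "W \<subseteq> cfun.span Q"
    by (rule cfun.basis_exists)
  define h where
    "h T = (case the_inv_into (P \<times> Q) (\<lambda>(p, q). tens p q) T of (p, q) \<Rightarrow> B p q)" for T
  obtain F where F: "Vector_Spaces.linear cscale s F"
    "\<forall>x\<in>(\<lambda>(p, q). tens p q) ` (P \<times> Q). F x = h x"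
    using linear_independent_extend[OF independent_tens(2)[OF P(2) Q(2)], of h] by blast
  interpret F: Vector_Spaces.linear cscale s F by fact
  have FPQ: "F (tens p q) = B p q" if "p \<in> P" "q \<in> Q" for p q
  proof -
    have "F (tens p q) = h (tens p q)" using F(2) that by force
    also have "\<dots> = B p q" unfolding h_def
      using the_inv_into_f_f[OF independent_tens(1)[OF P(2) Q(2)], of "(p, q)"] that by simp
    finally show ?thesis .
  qed
  have "bilinear_on V W s (\<lambda>f g. F (tens f g))"
  proof -
    have "tens (f + f') g = tens f g + tens f' g" "tens f (g + g') = tens f g + tens f g'"
      "tens (cscale c f) g = cscale c (tens f g)" "tens f (cscale c g) = cscale c (tens f g)"
      for f f' :: "'x \<Rightarrow> complex" and g g' :: "'y \<Rightarrow> complex" and c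
      by (auto simp: tens_def cscale_def fun_eq_iff algebra_simps)
    then show ?thesis
      by (auto simp: bilinear_on_def linear_on_def F.add F.scale)
  qed
  then have FB: "F (tens f g) = B f g" if "f \<in> V" "g \<in> W" for f g
    using bilinear_on_eq_on_span[OF s V P(1,3) W Q(1,3) _ B FPQ that] by blast
  have "linear_on (tensor_space V W) s F"
    by (auto simp: linear_on_def F.add F.scale)
  with FB have "\<exists>F. linear_on (tensor_space V W) s F \<and> (\<forall>f\<in>V. \<forall>g\<in>W. F (tens f g) = B f g)"
    by blast
  from someI_ex[OF this, folded tensor_lift_def]
  show "linear_on (tensor_space V W) s (tensor_lift s V W B)"
    and "\<And>f g. f \<in> V \<Longrightarrow> g \<in> W \<Longrightarrow> tensor_lift s V W B (tens f g) = B f g"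
    by blast+
qed

definition tensor_map ::
  "('x \<Rightarrow> complex) set \<Rightarrow> ('y \<Rightarrow> complex) set \<Rightarrow>
   (('x \<Rightarrow> complex) \<Rightarrow> 'z \<Rightarrow> complex) \<Rightarrow> (('y \<Rightarrow> complex) \<Rightarrow> 'w \<Rightarrow> complex) \<Rightarrow>
   ('x \<times> 'y \<Rightarrow> complex) \<Rightarrow> 'z \<times> 'w \<Rightarrow> complex" where
  "tensor_map V W \<phi> \<psi> = tensor_lift cscale V W (\<lambda>f g. tens (\<phi> f) (\<psi> g))"

definition tensor_assoc :: "(('x \<times> 'y) \<times> 'z \<Rightarrow> complex) \<Rightarrow> 'x \<times> 'y \<times> 'z \<Rightarrow> complex" where
  "tensor_assoc t = (\<lambda>(x, y, z). t ((x, y), z))"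

definition tensor_swap :: "('x \<times> 'y \<Rightarrow> complex) \<Rightarrow> 'y \<times> 'x \<Rightarrow> complex" where
  "tensor_swap t = (\<lambda>(y, x). t (x, y))"


section \<open>Bialgebras and Hopf algebras\<close>

record 'x bialg =
  carr :: "('x \<Rightarrow> complex) set"
  mlt :: "('x \<Rightarrow> complex) \<Rightarrow> ('x \<Rightarrow> complex) \<Rightarrow> 'x \<Rightarrow> complex"
  unt :: "'x \<Rightarrow> complex"
  comlt :: "('x \<Rightarrow> complex) \<Rightarrow> 'x \<times> 'x \<Rightarrow> complex"
  counit :: "('x \<Rightarrow> complex) \<Rightarrow> complex"

definition is_algebra :: "'x bialg \<Rightarrow> bool" where
  "is_algebra H \<longleftrightarrow>
     cfun.subspace (carr H) \<and>
     (\<forall>x\<in>carr H. \<forall>y\<in>carr H. mlt H x y \<in> carr H) \<and>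
     bilinear_on (carr H) (carr H) cscale (mlt H) \<and>
     (\<forall>x\<in>carr H. \<forall>y\<in>carr H. \<forall>z\<in>carr H. mlt H (mlt H x y) z = mlt H x (mlt H y z)) \<and>
     unt H \<in> carr H \<and>
     (\<forall>x\<in>carr H. mlt H (unt H) x = x \<and> mlt H x (unt H) = x)"

definition is_coalgebra :: "'x bialg \<Rightarrow> bool" where
  "is_coalgebra H \<longleftrightarrow>
     cfun.subspace (carr H) \<and>
     (\<forall>x\<in>carr H. comlt H x \<in> tensor_space (carr H) (carr H)) \<and>
     linear_on (carr H) cscale (comlt H) \<and>
     linear_on (carr H) (*) (counit H) \<and>
     (\<forall>x\<in>carr H.
        tensor_assoc (tensor_map (carr H) (carr H) (comlt H) id (comlt H x)) =
        tensor_map (carr H) (carr H) id (comlt H) (comlt H x)) \<and>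
     (\<forall>x\<in>carr H.
        tensor_lift cscale (carr H) (carr H) (\<lambda>a b. cscale (counit H a) b) (comlt H x) = x \<and>
        tensor_lift cscale (carr H) (carr H) (\<lambda>a b. cscale (counit H b) a) (comlt H x) = x)"

text \<open>The product \<open>(a \<otimes> b)(c \<otimes> d) = ac \<otimes> bd\<close> on the tensor square.\<close>

definition tensor_mult ::
  "'x bialg \<Rightarrow> ('x \<times> 'x \<Rightarrow> complex) \<Rightarrow> ('x \<times> 'x \<Rightarrow> complex) \<Rightarrow> 'x \<times> 'x \<Rightarrow> complex" where
  "tensor_mult H s t =
     tensor_lift cscale (carr H) (carr H)
       (\<lambda>a b. tensor_lift cscale (carr H) (carr H) (\<lambda>c d. tens (mlt H a c) (mlt H b d)) t) s"

definition is_bialgebra :: "'x bialg \<Rightarrow> bool" where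
  "is_bialgebra H \<longleftrightarrow>
     is_algebra H \<and> is_coalgebra H \<and>
     (\<forall>x\<in>carr H. \<forall>y\<in>carr H. comlt H (mlt H x y) = tensor_mult H (comlt H x) (comlt H y)) \<and>
     comlt H (unt H) = tens (unt H) (unt H) \<and>
     (\<forall>x\<in>carr H. \<forall>y\<in>carr H. counit H (mlt H x y) = counit H x * counit H y) \<and>
     counit H (unt H) = 1"

definition is_antipode :: "'x bialg \<Rightarrow> (('x \<Rightarrow> complex) \<Rightarrow> 'x \<Rightarrow> complex) \<Rightarrow> bool" where
  "is_antipode H S \<longleftrightarrow>
     (\<forall>x\<in>carr H. S x \<in> carr H) \<and> linear_on (carr H) cscale S \<and>
     (\<forall>x\<in>carr H.
        tensor_lift cscale (carr H) (carr H) (\<lambda>a b. mlt H (S a) b) (comlt H x)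
          = cscale (counit H x) (unt H) \<and>
        tensor_lift cscale (carr H) (carr H) (\<lambda>a b. mlt H a (S b)) (comlt H x)
          = cscale (counit H x) (unt H))"

definition is_hopf_algebra :: "'x bialg \<Rightarrow> bool" where
  "is_hopf_algebra H \<longleftrightarrow> is_bialgebra H \<and> (\<exists>S. is_antipode H S)"

definition is_cocommutative :: "'x bialg \<Rightarrow> bool" where
  "is_cocommutative H \<longleftrightarrow> (\<forall>x\<in>carr H. tensor_swap (comlt H x) = comlt H x)"

definition is_direct_sum ::
  "('x \<Rightarrow> complex) set \<Rightarrow> (nat \<Rightarrow> ('x \<Rightarrow> complex) set) \<Rightarrow> bool" where
  "is_direct_sum V G \<longleftrightarrow>
     (\<forall>n. cfun.subspace (G n)) \<and> V = cfun.span (\<Union>n. G n) \<and>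
     (\<forall>N x. (\<forall>n\<le>N. x n \<in> G n) \<and> (\<Sum>n\<le>N. x n) = 0 \<longrightarrow> (\<forall>n\<le>N. x n = 0))"

definition is_graded_hopf_algebra :: "'x bialg \<Rightarrow> (nat \<Rightarrow> ('x \<Rightarrow> complex) set) \<Rightarrow> bool" where
  "is_graded_hopf_algebra H G \<longleftrightarrow>
     is_bialgebra H \<and> is_direct_sum (carr H) G \<and>
     (\<forall>m n. \<forall>x\<in>G m. \<forall>y\<in>G n. mlt H x y \<in> G (m + n)) \<and>
     unt H \<in> G 0 \<and>
     (\<forall>n. \<forall>x\<in>G n. comlt H x \<in> cfun.span (\<Union>i\<le>n. tensor_space (G i) (G (n - i)))) \<and>
     (\<forall>n>0. \<forall>x\<in>G n. counit H x = 0) \<and>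
     (\<exists>S. is_antipode H S \<and> (\<forall>n. \<forall>x\<in>G n. S x \<in> G n))"

definition is_connected :: "'x bialg \<Rightarrow> (nat \<Rightarrow> ('x \<Rightarrow> complex) set) \<Rightarrow> bool" where
  "is_connected H G \<longleftrightarrow> G 0 = range (\<lambda>c. cscale c (unt H))"

text \<open>
  The graded dual consists of the linear functionals on \<open>carr H\<close> (extended by \<open>0\<close> outside
  \<open>carr H\<close>) that vanish on all but finitely many components \<open>G n\<close>. A tensor \<open>f \<otimes> g\<close> of
  functionals is the function \<open>(x, y) \<mapsto> f x * g y\<close>, so the coproduct dual to the product of
  \<open>H\<close> sends \<open>f\<close> to \<open>(x, y) \<mapsto> f (x y)\<close>.
\<close>

definition graded_dual ::
  "'x bialg \<Rightarrow> (nat \<Rightarrow> ('x \<Rightarrow> complex) set) \<Rightarrow> ('x \<Rightarrow> complex) bialg" where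
  "graded_dual H G =
     \<lparr> carr = {f. linear_on (carr H) (*) f \<and> (\<forall>x. x \<notin> carr H \<longrightarrow> f x = 0) \<and>
                  finite {n. \<exists>x\<in>G n. f x \<noteq> 0}},
       mlt = (\<lambda>f g x. if x \<in> carr H
                then tensor_lift (*) (carr H) (carr H) (\<lambda>a b. f a * g b) (comlt H x) else 0),
       unt = (\<lambda>x. if x \<in> carr H then counit H x else 0),
       comlt = (\<lambda>f (x, y). if x \<in> carr H \<and> y \<in> carr H then f (mlt H x y) else 0),
       counit = (\<lambda>f. f (unt H)) \<rparr>"

definition is_bialgebra_iso ::
  "'x bialg \<Rightarrow> 'y bialg \<Rightarrow> (('x \<Rightarrow> complex) \<Rightarrow> 'y \<Rightarrow> complex) \<Rightarrow> bool" where
  "is_bialgebra_iso H K \<phi> \<longleftrightarrow>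
     bij_betw \<phi> (carr H) (carr K) \<and> linear_on (carr H) cscale \<phi> \<and>
     (\<forall>x\<in>carr H. \<forall>y\<in>carr H. \<phi> (mlt H x y) = mlt K (\<phi> x) (\<phi> y)) \<and>
     \<phi> (unt H) = unt K \<and>
     (\<forall>x\<in>carr H. tensor_map (carr H) (carr H) \<phi> \<phi> (comlt H x) = comlt K (\<phi> x)) \<and>
     (\<forall>x\<in>carr H. counit K (\<phi> x) = counit H x)"

definition bialgebra_isomorphic :: "'x bialg \<Rightarrow> 'y bialg \<Rightarrow> bool" where
  "bialgebra_isomorphic H K \<longleftrightarrow> (\<exists>\<phi>. is_bialgebra_iso H K \<phi>)"


section \<open>Free associative algebras\<close>

text \<open>\<open>\<complex>\<langle>A\<rangle>\<close>: the finitely supported functions on the words over the alphabet \<open>A\<close>.\<close>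

definition free_alg :: "'a set \<Rightarrow> ('a list \<Rightarrow> complex) set" where
  "free_alg A = {x. finite {w. x w \<noteq> 0} \<and> {w. x w \<noteq> 0} \<subseteq> lists A}"

definition word :: "'a list \<Rightarrow> 'a list \<Rightarrow> complex" where
  "word w = (\<lambda>v. if v = w then 1 else 0)"

definition extend_linearly ::
  "('a list \<Rightarrow> 'y \<Rightarrow> complex) \<Rightarrow> ('a list \<Rightarrow> complex) \<Rightarrow> 'y \<Rightarrow> complex" where
  "extend_linearly B x = (\<Sum>w\<in>{w. x w \<noteq> 0}. cscale (x w) (B w))"

definition conc ::
  "('a list \<Rightarrow> complex) \<Rightarrow> ('a list \<Rightarrow> complex) \<Rightarrow> 'a list \<Rightarrow> complex" where
  "conc x y = extend_linearly (\<lambda>u. extend_linearly (\<lambda>v. word (u @ v)) y) x"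

definition deconc :: "('a list \<Rightarrow> complex) \<Rightarrow> 'a list \<times> 'a list \<Rightarrow> complex" where
  "deconc = extend_linearly (\<lambda>w. \<Sum>(u, v)\<in>{(u, v). u @ v = w}. tens (word u) (word v))"

text \<open>
  The bilinear pairing for which the basis of words (\<open>'b = 'a list\<close>), respectively of pairs of
  words \<open>u \<otimes> v\<close> (\<open>'b = 'a list \<times> 'a list\<close>), is orthonormal; \<open>s\<close> is finitely supported.
\<close>

definition pairing :: "('b \<Rightarrow> complex) \<Rightarrow> ('b \<Rightarrow> complex) \<Rightarrow> complex" where
  "pairing s t = (\<Sum>p\<in>{p. s p \<noteq> 0}. s p * t p)"

text \<open>
  The product on \<open>\<complex>\<langle>A\<rangle>\<close> characterized by \<open>(x \<Cup> y, w) = (x \<otimes> y, \<Delta> w)\<close> for all words \<open>w\<close> over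
  \<open>A\<close>. For \<open>A \<subseteq> \<Sigma>\<close> this is the product dual to the restriction of \<open>\<Delta>\<close> to \<open>\<complex>\<langle>A\<rangle>\<close>. The words over
  \<open>\<Sigma>\<close> that are not words over \<open>A\<close> have to be discarded: if \<open>\<Sigma> = {a, b}\<close>, \<open>a\<close> is primitive and
  \<open>\<Delta> b = b \<otimes> 1 + 1 \<otimes> b + a \<otimes> a\<close>, then the product of \<open>a\<close> with itself is \<open>2 a a + b\<close> in
  \<open>\<complex>\<langle>\<Sigma>\<rangle>\<close> but \<open>2 a a\<close> in \<open>\<complex>\<langle>{a}\<rangle>\<close>.
\<close>

definition cup ::
  "'a set \<Rightarrow> (('a list \<Rightarrow> complex) \<Rightarrow> 'a list \<times> 'a list \<Rightarrow> complex) \<Rightarrow>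
   ('a list \<Rightarrow> complex) \<Rightarrow> ('a list \<Rightarrow> complex) \<Rightarrow> 'a list \<Rightarrow> complex" where
  "cup A \<Delta> x y = (\<lambda>w. if w \<in> lists A then pairing (tens x y) (\<Delta> (word w)) else 0)"

definition conc_bialg ::
  "'a set \<Rightarrow> (('a list \<Rightarrow> complex) \<Rightarrow> 'a list \<times> 'a list \<Rightarrow> complex) \<Rightarrow>
   (('a list \<Rightarrow> complex) \<Rightarrow> complex) \<Rightarrow> 'a list bialg" where
  "conc_bialg A \<Delta> \<epsilon> =
     \<lparr> carr = free_alg A, mlt = conc, unt = word [], comlt = \<Delta>, counit = \<epsilon> \<rparr>"

definition cup_bialg ::
  "'a set \<Rightarrow> (('a list \<Rightarrow> complex) \<Rightarrow> 'a list \<times> 'a list \<Rightarrow> complex) \<Rightarrow> 'a list bialg" where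
  "cup_bialg A \<Delta> =
     \<lparr> carr = free_alg A, mlt = cup A \<Delta>, unt = word [], comlt = deconc,
       counit = (\<lambda>x. x []) \<rparr>"

text \<open>A graded alphabet is the disjoint union of finite sets \<open>{a\<in>A. deg a = n}\<close>, \<open>n \<ge> 1\<close>.\<close>

definition graded_alphabet :: "'a set \<Rightarrow> ('a \<Rightarrow> nat) \<Rightarrow> bool" where
  "graded_alphabet A deg \<longleftrightarrow> (\<forall>a\<in>A. deg a \<ge> 1) \<and> (\<forall>n. finite {a\<in>A. deg a = n})"

definition component :: "'a set \<Rightarrow> ('a \<Rightarrow> nat) \<Rightarrow> nat \<Rightarrow> ('a list \<Rightarrow> complex) set" where
  "component A deg n = {x \<in> free_alg A. \<forall>w. x w \<noteq> 0 \<longrightarrow> (\<Sum>a\<leftarrow>w. deg a) = n}"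

end

theory Submission
  imports Defs
begin

text \<open>
  Everything is computed in coordinates: a bialgebra structure on \<open>\<complex>\<langle>A\<rangle>\<close> that extends concatenation is
  given by the numbers \<open>(u \<otimes> v, \<Delta> w)\<close>. Since \<open>\<Delta>\<close> preserves the degree and there are finitely many
  words of each degree, all sums may be taken over the words of degree at most \<open>N\<close>, for \<open>N\<close> large.
  The axioms of \<open>(\<Cup>, \<Delta>\<^sub>\<cdot>)\<close> are then the transposed axioms of \<open>(\<cdot>, \<Delta>)\<close>, and the expansion of
  \<open>u1 \<Cup> u2\<close> is \<open>\<Delta> (a w) = \<Delta> a \<Delta> w\<close> read off at \<open>u1 \<otimes> u2\<close>. The antipode is the
  convolution inverse of the identity, built by recursion on the length of words. Multiplicativity
  of \<open>\<Delta>\<close> also extends the compatibility of \<open>\<Delta>\<close> with \<open>\<Sigma>'\<close> from letters to words.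
\<close>

section \<open>Linear and bilinear maps\<close>

text \<open>\<open>tensor_lift\<close> is a Hilbert choice whose value is known only on the tensor
  space of the carriers named in it. The lifts in the axioms over \<Sigma> and those over \<Sigma>'
  are therefore unrelated as terms, and each has to be turned into a finite sum over words before
  axioms can be transposed or restricted. The cup product of \<Sigma>' discards the words outside
  \<Sigma>', so it is in general not the restriction of the cup product of \<Sigma>, and no axiom
  about it can be inherited from there. Instead the concatenation bialgebra is restricted first, and
  its transpose is studied for an arbitrary alphabet A, in a locale whose assumptions pass to
  compatible subalphabets. The antipode is constructed directly on the transposed side, inside that
  same locale.\<close>

lemma sum_fun_apply: "(\<Sum>i\<in>I. h i) x = (\<Sum>i\<in>I. (h i x :: 'b::comm_monoid_add))"
  by (induction I rule: infinite_finite_induct) auto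

lemma vector_space_complex: "vector_space ((*) :: complex \<Rightarrow> complex \<Rightarrow> complex)"
  by unfold_locales (auto simp: algebra_simps)

lemma tens_add_left: "tens (f + f') g = tens f g + tens f' g"
  and tens_add_right: "tens f (g + g') = tens f g + tens f g'"
  and tens_scale_left: "tens (cscale c f) g = cscale c (tens f g)"
  and tens_scale_right: "tens f (cscale c g) = cscale c (tens f g)"
  by (auto simp: tens_def cscale_def fun_eq_iff algebra_simps)

lemma bilinear_on_tens:
  assumes "linear_on V cscale \<phi>" "linear_on W cscale \<psi>"
  shows "bilinear_on V W cscale (\<lambda>f g. tens (\<phi> f) (\<psi> g))"
  using assms unfolding bilinear_on_def linear_on_def
  by (simp add: tens_add_left tens_add_right tens_scale_left tens_scale_right)

lemma bilinear_on_sum: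
  assumes "vector_space s" "\<And>i. i \<in> I \<Longrightarrow> bilinear_on V W s (B i)"
  shows "bilinear_on V W s (\<lambda>f g. \<Sum>i\<in>I. B i f g)"
proof -
  interpret vector_space s by fact
  show ?thesis
    using assms(2) unfolding bilinear_on_def linear_on_def
    by (simp add: sum.distrib scale_sum_right)
qed

lemma bilinear_on_scale:
  assumes "vector_space s" "bilinear_on V W s B"
  shows "bilinear_on V W s (\<lambda>f g. s c (B f g))"
proof -
  interpret vector_space s by fact
  show ?thesis
    using assms(2) unfolding bilinear_on_def linear_on_def
    by (simp add: scale_right_distrib scale_left_commute)
qed

lemma linear_on_subset: "linear_on V s F \<Longrightarrow> V' \<subseteq> V \<Longrightarrow> linear_on V' s F"
  unfolding linear_on_def by blast

lemma bilinear_on_subset: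
  "bilinear_on V W s B \<Longrightarrow> V' \<subseteq> V \<Longrightarrow> W' \<subseteq> W \<Longrightarrow> bilinear_on V' W' s B"
  unfolding bilinear_on_def by (meson linear_on_subset subsetD)

section \<open>Coordinates on the free algebra\<close>

definition supp :: "('x \<Rightarrow> complex) \<Rightarrow> 'x set" where
  "supp x = {w. x w \<noteq> 0}"

lemma in_supp_iff [simp]: "w \<in> supp x \<longleftrightarrow> x w \<noteq> 0"
  by (simp add: supp_def)

lemma cscale_apply: "cscale c f x = c * f x"
  by (simp add: cscale_def)

lemma word_apply: "word w v = (if v = w then 1 else 0)"
  by (simp add: word_def)

lemma free_alg_iff: "x \<in> free_alg A \<longleftrightarrow> finite (supp x) \<and> supp x \<subseteq> lists A"
  by (simp add: free_alg_def supp_def)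

text \<open>The index type is arbitrary because the lemma serves twice: for words, giving
  \<open>free_alg\<close>, and for pairs of words, giving the tensor space.\<close>

lemma subspace_finite_supp: "cfun.subspace {x. finite (supp x) \<and> supp x \<subseteq> L}"
proof (rule cfun.subspaceI)
  fix x y :: "'a \<Rightarrow> complex" and c
  assume x: "x \<in> {x. finite (supp x) \<and> supp x \<subseteq> L}"
  have "supp (cscale c x) \<subseteq> supp x"
    by (auto simp: cscale_def)
  then show "cscale c x \<in> {x. finite (supp x) \<and> supp x \<subseteq> L}"
    using x finite_subset by blast
  assume y: "y \<in> {x. finite (supp x) \<and> supp x \<subseteq> L}"
  have "supp (x + y) \<subseteq> supp x \<union> supp y"
    by auto
  moreover have "finite (supp x \<union> supp y)"
    using x y by blast
  ultimately show "x + y \<in> {x. finite (supp x) \<and> supp x \<subseteq> L}"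
    using x y finite_subset by blast
qed (simp add: supp_def)

lemma subspace_free_alg: "cfun.subspace (free_alg A)"
  using subspace_finite_supp[of "lists A"] by (simp add: free_alg_def supp_def)

lemma free_alg_mono: "A \<subseteq> B \<Longrightarrow> free_alg A \<subseteq> free_alg B"
  by (meson free_alg_iff lists_mono subsetI subset_trans)

lemma word_in_free_alg: "w \<in> lists A \<Longrightarrow> word w \<in> free_alg A"
  by (auto simp: free_alg_def word_def)

lemma free_alg_eq_sum:
  assumes "finite W" "supp x \<subseteq> W"
  shows "x = (\<Sum>w\<in>W. cscale (x w) (word w))"
proof
  fix v
  have "(\<Sum>w\<in>W. cscale (x w) (word w)) v = (\<Sum>w\<in>W. if v = w then x v else 0)"
    unfolding sum_fun_apply by (rule sum.cong) (auto simp: cscale_def word_def)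
  then show "x v = (\<Sum>w\<in>W. cscale (x w) (word w)) v"
    using assms by auto
qed

lemma linear_on_free_alg:
  assumes "vector_space s" "linear_on (free_alg A) s F" "finite W" "W \<subseteq> lists A" "supp x \<subseteq> W"
  shows "F x = (\<Sum>w\<in>W. s (x w) (F (word w)))"
proof -
  have W: "word w \<in> free_alg A" if "w \<in> W" for w
    using that assms(4) by (auto intro: word_in_free_alg)
  have "F x = F (\<Sum>w\<in>W. cscale (x w) (word w))"
    using free_alg_eq_sum[OF assms(3,5)] by simp
  also have "\<dots> = (\<Sum>w\<in>W. F (cscale (x w) (word w)))"
    by (rule linear_on_sum[OF assms(2) subspace_free_alg _ assms(1)])
      (use W in \<open>auto intro: cfun.subspace_scale subspace_free_alg\<close>)
  also have "\<dots> = (\<Sum>w\<in>W. s (x w) (F (word w)))"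
    using assms(2) W by (intro sum.cong refl) (simp add: linear_on_def)
  finally show ?thesis .
qed

text \<open>The defining sum runs over the support, which varies with the argument. Passing to a
  finite superset lets two arguments be compared over a common index set, which is how additivity is
  obtained.\<close>

lemma extend_linearly_eq:
  assumes "finite W" "supp x \<subseteq> W"
  shows "extend_linearly B x = (\<Sum>w\<in>W. cscale (x w) (B w))"
  unfolding extend_linearly_def
  by (rule sum.mono_neutral_left) (use assms in \<open>auto simp: supp_def cscale_def fun_eq_iff\<close>)

lemma extend_linearly_word: "extend_linearly B (word w) = B w"
  by (subst extend_linearly_eq[of "{w}"]) (auto simp: word_def cscale_def split: if_splits)

lemma linear_on_extend_linearly: "linear_on (free_alg A) cscale (extend_linearly B)"
proof -
  have "extend_linearly B (x + y) = extend_linearly B x + extend_linearly B y"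
    if "finite (supp x)" "finite (supp y)" for x y
    using that
    by (subst (1 2 3) extend_linearly_eq[of "supp x \<union> supp y"])
      (auto simp: sum.distrib[symmetric] cfun.scale_left_distrib intro!: sum.cong)
  moreover have "extend_linearly B (cscale c x) = cscale c (extend_linearly B x)"
    if "finite (supp x)" for x c
    using that
    by (subst (1 2) extend_linearly_eq[of "supp x"])
      (auto simp: fun_eq_iff sum_fun_apply cscale_def mult.assoc sum_distrib_left)
  ultimately show ?thesis
    by (simp add: linear_on_def free_alg_iff)
qed

lemma conc_word: "conc (word u) (word v) = word (u @ v)"
  by (simp add: conc_def extend_linearly_word)

text \<open>A factorization is determined by the place of the cut, an index at most
  \<open>length w\<close>.\<close>

lemma finite_splits [simp]: "finite {(u, v). u @ v = w}"
proof (rule finite_subset)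
  show "{(u, v). u @ v = w} \<subseteq> (\<lambda>i. (take i w, drop i w)) ` {..length w}"
    by (clarify, rule_tac x = "length a" in image_eqI) auto
qed simp

text \<open>Deconcatenation is the transpose of concatenation: \<open>u \<otimes> v\<close> occurs
  only in the coproduct of the word \<open>u @ v\<close>. Finite support matters because
  \<open>extend_linearly\<close> sums over the support, and a sum over an infinite set is 0 by
  convention.\<close>

lemma deconc_apply:
  assumes "finite (supp x)"
  shows "deconc x (u, v) = x (u @ v)"
proof -
  have "(\<Sum>(a, b)\<in>{(a, b). a @ b = w}. tens (word a) (word b)) (u, v) = (if u @ v = w then 1 else 0)" for w :: "'a list"
  proof -
    have "(\<Sum>(a, b)\<in>{(a, b). a @ b = w}. tens (word a) (word b)) (u, v)
        = (\<Sum>p\<in>{(a, b). a @ b = w}. if (u, v) = p then 1 else 0)"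
      unfolding sum_fun_apply by (rule sum.cong) (auto simp: tens_def word_def split: if_splits)
    then show ?thesis by simp
  qed
  then have "deconc x (u, v) = (\<Sum>w\<in>supp x. if u @ v = w then x w else 0)"
    unfolding deconc_def extend_linearly_eq[OF assms subset_refl] sum_fun_apply
    by (intro sum.cong refl) (simp add: cscale_def)
  then show ?thesis using assms by auto
qed

section \<open>Tensors as finitely supported functions on pairs of words\<close>

lemma tens_word_apply: "tens (word u) (word v) p = (if p = (u, v) then 1 else 0)"
  by (cases p) (auto simp: tens_def word_def)

text \<open>The tensors of two words are the indicators of pairs of words. Membership in a tensor
  space thereby becomes a condition on the support, and this is how compatibility with a subalphabet
  is exploited.\<close>

lemma tensor_space_free_alg:
  "tensor_space (free_alg A) (free_alg B) = {t. finite (supp t) \<and> supp t \<subseteq> lists A \<times> lists B}"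
proof
  show "tensor_space (free_alg A) (free_alg B) \<subseteq> {t :: 'a list \<times> 'b list \<Rightarrow> complex. finite (supp t) \<and> supp t \<subseteq> lists A \<times> lists B}"
    unfolding tensor_space_def
  proof (rule cfun.span_minimal[OF _ subspace_finite_supp])
    have *: "supp (tens f g) = supp f \<times> supp g" for f :: "'a list \<Rightarrow> complex" and g :: "'b list \<Rightarrow> complex"
      by (auto simp: tens_def)
    show "{tens f g |f g. f \<in> free_alg A \<and> g \<in> free_alg B}
        \<subseteq> {t. finite (supp t) \<and> supp t \<subseteq> lists A \<times> lists B}"
    proof clarify
      fix f :: "'a list \<Rightarrow> complex" and g :: "'b list \<Rightarrow> complex"
      assume "f \<in> free_alg A" "g \<in> free_alg B"
      then show "finite (supp (tens f g)) \<and> supp (tens f g) \<subseteq> lists A \<times> lists B"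
        unfolding free_alg_iff * by blast
    qed
  qed
  show "{t. finite (supp t) \<and> supp t \<subseteq> lists A \<times> lists B} \<subseteq> tensor_space (free_alg A) (free_alg B)"
  proof clarify
    fix t :: "'a list \<times> 'b list \<Rightarrow> complex"
    assume t: "finite (supp t)" "supp t \<subseteq> lists A \<times> lists B"
    have "t = (\<Sum>(u, v)\<in>supp t. cscale (t (u, v)) (tens (word u) (word v)))"
    proof
      fix p
      have "(\<Sum>(u, v)\<in>supp t. cscale (t (u, v)) (tens (word u) (word v))) p
          = (\<Sum>q\<in>supp t. if p = q then t p else 0)"
        unfolding sum_fun_apply by (rule sum.cong) (auto simp: tens_word_apply cscale_def)
      then show "t p = (\<Sum>(u, v)\<in>supp t. cscale (t (u, v)) (tens (word u) (word v))) p"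
        using t by auto
    qed
    also have "\<dots> \<in> tensor_space (free_alg A) (free_alg B)"
      unfolding tensor_space_def
    proof (rule cfun.span_sum)
      fix p assume "p \<in> supp t"
      then obtain u v where p: "p = (u, v)" "u \<in> lists A" "v \<in> lists B"
        using t(2) by blast
      have "tens (word u) (word v) \<in> {tens f g |f g. f \<in> free_alg A \<and> g \<in> free_alg B}"
        unfolding mem_Collect_eq using word_in_free_alg[OF p(2)] word_in_free_alg[OF p(3)]
        by (intro exI[of _ "word u"] exI[of _ "word v"]) simp
      then show "(case p of (u, v) \<Rightarrow> cscale (t (u, v)) (tens (word u) (word v)))
          \<in> cfun.span {tens f g |f g. f \<in> free_alg A \<and> g \<in> free_alg B}"
        unfolding p prod.case by (intro cfun.span_scale cfun.span_base)
    qed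
    finally show "t \<in> tensor_space (free_alg A) (free_alg B)" .
  qed
qed

lemma subspace_tensor_space: "cfun.subspace (tensor_space V W)"
  unfolding tensor_space_def by (rule cfun.subspace_span)

lemma tens_in_tensor_space: "f \<in> V \<Longrightarrow> g \<in> W \<Longrightarrow> tens f g \<in> tensor_space V W"
  unfolding tensor_space_def by (intro cfun.span_base) blast

text \<open>A bilinear map enters \<open>tensor_lift\<close> only through its values on V and W, so
  the two choice predicates coincide. The equation therefore holds for every t, also outside the
  tensor space.\<close>

lemma tensor_lift_cong:
  assumes "\<And>f g. f \<in> V \<Longrightarrow> g \<in> W \<Longrightarrow> B f g = B' f g"
  shows "tensor_lift s V W B t = tensor_lift s V W B' t"
proof -
  have "(\<forall>f\<in>V. \<forall>g\<in>W. F (tens f g) = B f g) \<longleftrightarrow> (\<forall>f\<in>V. \<forall>g\<in>W. F (tens f g) = B' f g)" for F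
    using assms by simp
  then show ?thesis
    unfolding tensor_lift_def by presburger
qed

text \<open>On the tensor space the chosen map is determined by linearity, and t is a finite
  combination of tensors of words. U and V need only cover the support, so they can be fitted to the
  other sums of a computation.\<close>

lemma tensor_lift_free_alg:
  assumes s: "vector_space s" and B: "bilinear_on (free_alg A) (free_alg C) s B"
    and U: "finite U" "U \<subseteq> lists A" and V: "finite V" "V \<subseteq> lists C" and t: "supp t \<subseteq> U \<times> V"
  shows "tensor_lift s (free_alg A) (free_alg C) B t
    = (\<Sum>u\<in>U. \<Sum>v\<in>V. s (t (u, v)) (B (word u) (word v)))"
proof -
  let ?T = "tensor_space (free_alg A) (free_alg C)" and ?F = "tensor_lift s (free_alg A) (free_alg C) B"
  note lift = tensor_lift[OF s subspace_free_alg subspace_free_alg B]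
  have W: "tens (word u) (word v) \<in> ?T" if "(u, v) \<in> U \<times> V" for u v
    using that U V by (intro tens_in_tensor_space word_in_free_alg) auto
  have "t = (\<Sum>(u, v)\<in>U \<times> V. cscale (t (u, v)) (tens (word u) (word v)))"
  proof
    fix p
    have "(\<Sum>(u, v)\<in>U \<times> V. cscale (t (u, v)) (tens (word u) (word v))) p
        = (\<Sum>q\<in>U \<times> V. if p = q then t p else 0)"
      unfolding sum_fun_apply by (rule sum.cong) (auto simp: tens_word_apply cscale_def)
    also have "\<dots> = t p"
      using U V t by (cases "t p = 0") (auto simp: supp_def)
    finally show "t p = (\<Sum>(u, v)\<in>U \<times> V. cscale (t (u, v)) (tens (word u) (word v))) p" ..
  qed
  then have "?F t = ?F (\<Sum>(u, v)\<in>U \<times> V. cscale (t (u, v)) (tens (word u) (word v)))"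
    by simp
  also have "\<dots> = (\<Sum>(u, v)\<in>U \<times> V. ?F (cscale (t (u, v)) (tens (word u) (word v))))"
    by (subst linear_on_sum[OF lift(1) subspace_tensor_space _ s])
      (use W in \<open>auto simp: case_prod_unfold intro: cfun.subspace_scale subspace_tensor_space\<close>)
  also have "\<dots> = (\<Sum>(u, v)\<in>U \<times> V. s (t (u, v)) (B (word u) (word v)))"
  proof (rule sum.cong[OF refl], clarify)
    fix u v assume uv: "u \<in> U" "v \<in> V"
    then have "?F (tens (word u) (word v)) = B (word u) (word v)"
      using U V by (intro lift(2) word_in_free_alg) auto
    then show "?F (cscale (t (u, v)) (tens (word u) (word v))) = s (t (u, v)) (B (word u) (word v))"
      using lift(1) W[of u v] uv by (simp add: linear_on_def)
  qed
  finally show ?thesis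
    by (simp add: sum.cartesian_product)
qed

lemma tensor_space_suppE:
  assumes "t \<in> tensor_space (free_alg A) (free_alg C)"
  obtains U V where "finite U" "U \<subseteq> lists A" "finite V" "V \<subseteq> lists C" "supp t \<subseteq> U \<times> V"
proof
  have t: "finite (supp t)" "supp t \<subseteq> lists A \<times> lists C"
    using assms by (auto simp: tensor_space_free_alg)
  then show "finite (fst ` supp t)" "finite (snd ` supp t)"
    by simp_all
  have "fst p \<in> lists A \<and> snd p \<in> lists C" if "p \<in> supp t" for p
    using subsetD[OF t(2) that] by (simp only: mem_Times_iff)
  then show "fst ` supp t \<subseteq> lists A" "snd ` supp t \<subseteq> lists C"
    by blast+
  show "supp t \<subseteq> fst ` supp t \<times> snd ` supp t"
    by (rule subset_fst_snd)
qed

text \<open>The lifts over A' and over A are separate choices, but both evaluate to the same finite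
  sum over words of A'.\<close>

lemma tensor_lift_restrict:
  assumes "vector_space s" "bilinear_on (free_alg A) (free_alg A) s B" "A' \<subseteq> A"
    and "t \<in> tensor_space (free_alg A') (free_alg A')"
  shows "tensor_lift s (free_alg A') (free_alg A') B t = tensor_lift s (free_alg A) (free_alg A) B t"
proof -
  obtain U V where UV: "finite U" "U \<subseteq> lists A'" "finite V" "V \<subseteq> lists A'" "supp t \<subseteq> U \<times> V"
    using tensor_space_suppE[OF assms(4)] .
  have sub: "free_alg A' \<subseteq> free_alg A" "lists A' \<subseteq> lists A"
    using assms(3) by (rule free_alg_mono, rule lists_mono)
  show ?thesis
    unfolding tensor_lift_free_alg[OF assms(1) bilinear_on_subset[OF assms(2) sub(1,1)] UV]
      tensor_lift_free_alg[OF assms(1,2) UV(1) order_trans[OF UV(2) sub(2)] UV(3)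
        order_trans[OF UV(4) sub(2)] UV(5)] ..
qed

lemma tensor_mult_free_alg:
  assumes H: "carr H = free_alg A" and m: "bilinear_on (free_alg A) (free_alg A) cscale (mlt H)"
    and U: "finite U" "U \<subseteq> lists A" "supp s \<subseteq> U \<times> U"
    and V: "finite V" "V \<subseteq> lists A" "supp t \<subseteq> V \<times> V"
  shows "tensor_mult H s t (x, y) = (\<Sum>a\<in>U. \<Sum>b\<in>U. \<Sum>c\<in>V. \<Sum>d\<in>V.
    s (a, b) * (t (c, d) * (mlt H (word a) (word c) x * mlt H (word b) (word d) y)))"
proof -
  let ?F = "free_alg A"
  \<comment> \<open>Closed form of the inner lift, visibly bilinear in a and b as the outer lift
    requires. It agrees with the inner lift on the carrier, which suffices by
    \<open>tensor_lift_cong\<close>.\<close>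
  define inner where "inner a b = (\<Sum>c\<in>V. \<Sum>d\<in>V. cscale (t (c, d)) (tens (mlt H a (word c)) (mlt H b (word d))))" for a b
  have *: "tensor_lift cscale ?F ?F (\<lambda>c d. tens (mlt H a c) (mlt H b d)) t = inner a b"
    if "a \<in> ?F" "b \<in> ?F" for a b
  proof -
    have "bilinear_on ?F ?F cscale (\<lambda>c d. tens (mlt H a c) (mlt H b d))"
      by (rule bilinear_on_tens) (use that m in \<open>simp_all add: bilinear_on_def\<close>)
    from tensor_lift_free_alg[OF cfun.vector_space_axioms this V(1,2) V(1,2) V(3)]
    show ?thesis unfolding inner_def .
  qed
  have w: "word c \<in> ?F" if "c \<in> V" for c
    using that V(2) by (auto intro: word_in_free_alg)
  have bil: "bilinear_on ?F ?F cscale inner"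
    unfolding inner_def
    by (rule bilinear_on_sum[OF cfun.vector_space_axioms], rule bilinear_on_sum[OF cfun.vector_space_axioms],
      rule bilinear_on_scale[OF cfun.vector_space_axioms], rule bilinear_on_tens)
      (use m w in \<open>simp_all add: bilinear_on_def\<close>)
  have "tensor_mult H s t = tensor_lift cscale ?F ?F inner s"
    unfolding tensor_mult_def H using * by (intro tensor_lift_cong) simp
  also have "\<dots> = (\<Sum>a\<in>U. \<Sum>b\<in>U. cscale (s (a, b)) (inner (word a) (word b)))"
    by (rule tensor_lift_free_alg[OF cfun.vector_space_axioms bil U(1,2) U(1,2) U(3)])
  finally show ?thesis
    by (simp add: inner_def sum_fun_apply cscale_def tens_def sum_distrib_left)
qed

text \<open>\<open>pairing\<close> sums over the support of its first argument. Here the range comes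
  from the second one, which is the one bounded by degree in the applications.\<close>

lemma pairing_eq_sum:
  assumes "finite (supp s)" "finite P" "supp t \<subseteq> P"
  shows "pairing s t = (\<Sum>p\<in>P. s p * t p)"
proof -
  have "pairing s t = (\<Sum>p\<in>supp s \<inter> P. s p * t p)"
    unfolding pairing_def supp_def[symmetric]
    by (rule sum.mono_neutral_right) (use assms in auto)
  also have "\<dots> = (\<Sum>p\<in>P. s p * t p)"
    by (rule sum.mono_neutral_left) (use assms in auto)
  finally show ?thesis .
qed

lemma pairing_word: "pairing (tens (word u) (word v)) t = t (u, v)"
proof -
  have "{p. tens (word u) (word v) p \<noteq> 0} = {(u, v)}"
    by (auto simp: tens_word_apply split: if_splits)
  then show ?thesis by (simp add: pairing_def tens_word_apply)
qed

section \<open>Sums over factorizations of words\<close>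

lemma finite_double_splits [simp]: "finite {(p1, v1, p2, v2). u1 = p1 @ v1 \<and> u2 = p2 @ v2}"
proof (rule finite_subset)
  show "{(p1, v1, p2, v2). u1 = p1 @ v1 \<and> u2 = p2 @ v2}
    \<subseteq> (\<lambda>((p1, v1), (p2, v2)). (p1, v1, p2, v2)) ` ({(u, v). u @ v = u1} \<times> {(u, v). u @ v = u2})"
    by (force simp: image_iff)
  show "finite ((\<lambda>((p1, v1), (p2, v2)). (p1, v1, p2, v2)) ` ({(u, v). u @ v = u1} \<times> {(u, v). u @ v = u2}))"
    by (intro finite_imageI finite_cartesian_product finite_splits)
qed

text \<open>The point (p, q) may lie outside the range as long as f vanishes there. This spares a
  case distinction when the range is a truncation by degree.\<close>

lemma sum_pair_delta:
  fixes f :: "'i \<Rightarrow> 'j \<Rightarrow> complex"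
  assumes "finite P" "finite Q" "p \<notin> P \<or> q \<notin> Q \<Longrightarrow> f p q = 0"
  shows "(\<Sum>a\<in>P. \<Sum>b\<in>Q. if a = p \<and> b = q then f a b else 0) = f p q"
proof -
  have "(\<Sum>a\<in>P. \<Sum>b\<in>Q. if a = p \<and> b = q then f a b else 0)
      = (\<Sum>a\<in>P. if a = p then (\<Sum>b\<in>Q. if b = q then f p b else 0) else 0)"
    by (intro sum.cong refl) (auto intro!: sum.neutral)
  then show ?thesis using assms by auto
qed

lemma sum_rotate:
  "(\<Sum>c\<in>R. \<Sum>a\<in>P. \<Sum>b\<in>Q. f a b c) = (\<Sum>a\<in>P. \<Sum>b\<in>Q. \<Sum>c\<in>R. f a b c)"
  by (rule trans[OF sum.swap], rule sum.cong[OF refl]) (rule sum.swap)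

lemma splits_Nil: "{(u, v). u @ v = []} = {([], [])}"
  by auto

lemma sum_splits_Nil_left:
  fixes w :: "'b list"
  shows "(\<Sum>(u, v)\<in>{(u, v). u @ v = w}. if u = [] then f v else 0) = f w"
proof -
  have "(\<Sum>(u, v)\<in>{(u, v). u @ v = w}. if u = [] then f v else 0) = (\<Sum>(u, v)\<in>{([] :: 'b list, w)}. f v)"
    by (rule sum.mono_neutral_cong_right) (auto split: if_splits)
  then show ?thesis by simp
qed

lemma sum_splits_Nil_right:
  fixes w :: "'b list"
  shows "(\<Sum>(u, v)\<in>{(u, v). u @ v = w}. if v = [] then f u else 0) = f w"
proof -
  have "(\<Sum>(u, v)\<in>{(u, v). u @ v = w}. if v = [] then f u else 0) = (\<Sum>(u, v)\<in>{(w, [] :: 'b list)}. f u)"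
    by (rule sum.mono_neutral_cong_right) (auto split: if_splits)
  then show ?thesis by simp
qed

text \<open>Both sides run over the factorizations of w into three words. This is coassociativity of
  deconcatenation in summation form, needed for the associativity of convolution.\<close>

lemma sum_splits_assoc:
  "(\<Sum>(p, z)\<in>{(p, z). p @ z = w}. \<Sum>(x, y)\<in>{(x, y). x @ y = p}. f x y z)
    = (\<Sum>(x, q)\<in>{(x, q). x @ q = w}. \<Sum>(y, z)\<in>{(y, z). y @ z = q}. f x y z)"
proof -
  let ?S = "\<lambda>w. {(u, v). u @ v = w}"
  have "(\<Sum>(p, z)\<in>?S w. \<Sum>(x, y)\<in>?S p. f x y z)
      = (\<Sum>t\<in>?S w. \<Sum>s\<in>?S (fst t). f (fst s) (snd s) (snd t))"
    by (rule sum.cong) (auto intro!: sum.cong)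
  also have "\<dots> = (\<Sum>(t, s)\<in>Sigma (?S w) (\<lambda>t. ?S (fst t)). f (fst s) (snd s) (snd t))"
    by (rule sum.Sigma) auto
  also have "\<dots> = (\<Sum>(t, s)\<in>Sigma (?S w) (\<lambda>t. ?S (snd t)). f (fst t) (fst s) (snd s))"
    by (rule sum.reindex_bij_witness[of _ "\<lambda>((x, q), (y, z)). ((x @ y, z), (x, y))"
          "\<lambda>((p, z), (x, y)). ((x, y @ z), (y, z))"]) auto
  also have "\<dots> = (\<Sum>t\<in>?S w. \<Sum>s\<in>?S (snd t). f (fst t) (fst s) (snd s))"
    by (rule sum.Sigma[symmetric]) auto
  also have "\<dots> = (\<Sum>(x, q)\<in>?S w. \<Sum>(y, z)\<in>?S q. f x y z)"
    by (rule sum.cong) (auto intro!: sum.cong)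
  finally show ?thesis .
qed

text \<open>Left multiplication by a letter is undone by removing the first letter; the expansion of
  the cup product can thus be checked at each word separately.\<close>

lemma conc_letter_apply:
  assumes "finite (supp z)"
  shows "conc (word [a]) z w = (if w \<noteq> [] \<and> hd w = a then z (tl w) else 0)"
proof -
  have "conc (word [a]) z w = (\<Sum>v\<in>supp z. if w = a # v then z v else 0)"
    unfolding conc_def extend_linearly_word extend_linearly_eq[OF assms subset_refl] sum_fun_apply
    by (intro sum.cong refl) (simp add: cscale_apply word_apply)
  also have "\<dots> = (\<Sum>v\<in>supp z. if v = tl w then (if w \<noteq> [] \<and> hd w = a then z (tl w) else 0) else 0)"
    by (intro sum.cong refl) (cases w; auto)
  finally show ?thesis using assms by auto
qed

lemma conc_apply:
  assumes "finite W" "supp x \<subseteq> W" "supp y \<subseteq> W"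
  shows "conc x y w = (\<Sum>u\<in>W. \<Sum>v\<in>W. if w = u @ v then x u * y v else 0)"
  unfolding conc_def extend_linearly_eq[OF assms(1,2)] extend_linearly_eq[OF assms(1,3)]
  by (auto simp: sum_fun_apply cscale_apply sum_distrib_left word_apply intro!: sum.cong)

lemma conc_in_free_alg:
  assumes "x \<in> free_alg A" "y \<in> free_alg A"
  shows "conc x y \<in> free_alg A"
  unfolding conc_def extend_linearly_def
proof (intro cfun.subspace_sum cfun.subspace_scale subspace_free_alg word_in_free_alg)
  fix u v assume "u \<in> {w. x w \<noteq> 0}" "v \<in> {w. y w \<noteq> 0}"
  then have "u \<in> lists A" "v \<in> lists A" using assms by (simp_all add: free_alg_def subset_iff)
  then show "u @ v \<in> lists A" by simp
qed

section \<open>Graded bialgebra structures on the concatenation algebra\<close>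

text \<open>The assumptions are chosen to pass to compatible subalphabets.
  \<open>homogeneous\<close> is the grading of the coproduct in coordinates;
  \<open>counit_word\<close> combines the normalization of the counit at 1 with its vanishing in
  positive degree.\<close>

locale graded_word_bialgebra =
  fixes A :: "'a set" and deg :: "'a \<Rightarrow> nat"
    and \<Delta> :: "('a list \<Rightarrow> complex) \<Rightarrow> 'a list \<times> 'a list \<Rightarrow> complex"
    and \<epsilon> :: "('a list \<Rightarrow> complex) \<Rightarrow> complex"
  assumes alphabet: "graded_alphabet A deg"
    and bialgebra: "is_bialgebra (conc_bialg A \<Delta> \<epsilon>)"
    and homogeneous: "\<And>w u v. w \<in> lists A \<Longrightarrow> \<Delta> (word w) (u, v) \<noteq> 0 \<Longrightarrow>
      (\<Sum>a\<leftarrow>u. deg a) + (\<Sum>a\<leftarrow>v. deg a) = (\<Sum>a\<leftarrow>w. deg a)"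
    and counit_word: "\<And>w. w \<in> lists A \<Longrightarrow> \<epsilon> (word w) = (if w = [] then 1 else 0)"
begin

section \<open>Words of bounded degree\<close>

abbreviation wdeg :: "'a list \<Rightarrow> nat" where
  "wdeg w \<equiv> \<Sum>a\<leftarrow>w. deg a"

text \<open>The range of most sums below. The bound is an inequality so that one N can serve several
  words and all their factors at once.\<close>

definition words :: "nat \<Rightarrow> 'a list set" where
  "words N = {w \<in> lists A. wdeg w \<le> N}"

lemma length_le_wdeg: "w \<in> lists A \<Longrightarrow> length w \<le> wdeg w"
proof (induction w)
  case (Cons a w)
  then have "1 \<le> deg a" using alphabet by (simp add: graded_alphabet_def)
  with Cons show ?case by simp
qed simp

text \<open>Letters of a word of degree at most N have degree at most N, which leaves finitely many
  of them; as letters have positive degree, the length is at most N too.\<close>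

lemma finite_words [simp]: "finite (words N)"
proof (rule finite_subset)
  let ?B = "\<Union>n\<le>N. {a \<in> A. deg a = n}"
  show "finite {w. set w \<subseteq> ?B \<and> length w \<le> N}"
    using alphabet by (intro finite_lists_length_le) (simp add: graded_alphabet_def)
  show "words N \<subseteq> {w. set w \<subseteq> ?B \<and> length w \<le> N}"
  proof
    fix w assume w: "w \<in> words N"
    have "set w \<subseteq> ?B"
    proof
      fix a assume "a \<in> set w"
      then have "deg a \<le> wdeg w" by (simp add: member_le_sum_list)
      then show "a \<in> ?B" using w \<open>a \<in> set w\<close> by (auto simp: words_def)
    qed
    then show "w \<in> {w. set w \<subseteq> ?B \<and> length w \<le> N}"
      using w length_le_wdeg[of w] by (auto simp: words_def)
  qed
qed

lemma words_subset: "words N \<subseteq> lists A"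
  by (auto simp: words_def)

lemma words_listsD: "w \<in> words N \<Longrightarrow> w \<in> lists A"
  by (simp add: words_def)

lemma words_mono: "M \<le> N \<Longrightarrow> words M \<subseteq> words N"
  by (auto simp: words_def)

lemma self_in_words: "w \<in> lists A \<Longrightarrow> wdeg w \<le> N \<Longrightarrow> w \<in> words N"
  by (simp add: words_def)

lemma Nil_in_words [simp]: "[] \<in> words N"
  by (simp add: words_def)

lemma append_in_words: "u \<in> words M \<Longrightarrow> v \<in> words N \<Longrightarrow> u @ v \<in> words (M + N)"
  by (auto simp: words_def)

lemma append_in_wordsD:
  assumes "u @ v \<in> words N" shows "u \<in> words N" "v \<in> words N"
  using assms by (auto simp: words_def)

lemma finite_subset_words:
  assumes "finite S" "S \<subseteq> lists A"
  obtains N where "S \<subseteq> words N"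
proof
  \<comment> \<open>The sum of all degrees bounds each of them and, unlike a maximum, also makes
    sense for empty S.\<close>
  show "S \<subseteq> words (\<Sum>w\<in>S. wdeg w)"
    using assms by (auto simp: words_def subset_iff intro: member_le_sum)
qed

lemma supp_subset_words:
  assumes "x \<in> free_alg A"
  obtains N where "supp x \<subseteq> words N"
  using assms finite_subset_words[of "supp x"] by (auto simp only: free_alg_iff)

lemma word_in: "w \<in> words N \<Longrightarrow> word w \<in> free_alg A"
  by (rule word_in_free_alg[OF words_listsD])

section \<open>The axioms of the given bialgebra, read off on words\<close>

lemma coalgebra: "is_coalgebra (conc_bialg A \<Delta> \<epsilon>)"
  using bialgebra by (simp only: is_bialgebra_def)

lemma comult_in_tensor_space: "x \<in> free_alg A \<Longrightarrow> \<Delta> x \<in> tensor_space (free_alg A) (free_alg A)"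
  and linear_comult: "linear_on (free_alg A) cscale \<Delta>"
  and linear_counit: "linear_on (free_alg A) (*) \<epsilon>"
  using coalgebra by (simp_all add: is_coalgebra_def conc_bialg_def)

lemma bilinear_conc: "bilinear_on (free_alg A) (free_alg A) cscale conc"
  using bialgebra by (simp add: is_bialgebra_def is_algebra_def conc_bialg_def)

lemma comult_eq_sum:
  assumes "supp x \<subseteq> words N"
  shows "\<Delta> x p = (\<Sum>w\<in>words N. x w * \<Delta> (word w) p)"
  unfolding linear_on_free_alg[OF cfun.vector_space_axioms linear_comult finite_words words_subset assms]
    sum_fun_apply cscale_def ..

lemma counit_eq:
  assumes "x \<in> free_alg A"
  shows "\<epsilon> x = x []"
proof -
  obtain N where N: "supp x \<subseteq> words N" using supp_subset_words[OF assms] .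
  have "\<epsilon> x = (\<Sum>w\<in>words N. x w * \<epsilon> (word w))"
    by (rule linear_on_free_alg[OF vector_space_complex linear_counit finite_words words_subset N])
  also have "\<dots> = (\<Sum>w\<in>words N. if w = [] then x w else 0)"
    by (rule sum.cong) (auto simp: counit_word words_listsD)
  finally show ?thesis by simp
qed

text \<open>The degrees of the two factors add up to that of w, so each is at most N. Iterated
  coproducts stay within the same truncation, and one N suffices for \<open>coassoc\<close>.\<close>

lemma comult_in_words:
  assumes "w \<in> words N" "\<Delta> (word w) (u, v) \<noteq> 0"
  shows "u \<in> words N" "v \<in> words N"
proof -
  have "supp (\<Delta> (word w)) \<subseteq> lists A \<times> lists A"
    using comult_in_tensor_space[OF word_in[OF assms(1)]] by (simp add: tensor_space_free_alg)
  then have "u \<in> lists A" "v \<in> lists A" using assms(2) by auto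
  moreover have "wdeg u + wdeg v \<le> N"
    using homogeneous[OF words_listsD[OF assms(1)] assms(2)] assms(1) by (simp add: words_def)
  ultimately show "u \<in> words N" "v \<in> words N" by (simp_all add: words_def)
qed

lemma supp_comult: "w \<in> words N \<Longrightarrow> supp (\<Delta> (word w)) \<subseteq> words N \<times> words N"
  by (auto dest: comult_in_words)

lemma supp_comult_free_alg:
  assumes "supp x \<subseteq> words N"
  shows "supp (\<Delta> x) \<subseteq> words N \<times> words N"
proof
  fix p assume "p \<in> supp (\<Delta> x)"
  then have "(\<Sum>w\<in>words N. x w * \<Delta> (word w) p) \<noteq> 0"
    using comult_eq_sum[OF assms] by simp
  then obtain w where "w \<in> words N" "\<Delta> (word w) p \<noteq> 0"
    by (metis (mono_tags, lifting) mult_zero_right sum.neutral)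
  then show "p \<in> words N \<times> words N" using supp_comult[of w N] by auto
qed

lemma tensor_lift_words:
  assumes "vector_space s" "bilinear_on (free_alg A) (free_alg A) s B" "supp t \<subseteq> words N \<times> words N"
  shows "tensor_lift s (free_alg A) (free_alg A) B t
    = (\<Sum>u\<in>words N. \<Sum>v\<in>words N. s (t (u, v)) (B (word u) (word v)))"
  by (rule tensor_lift_free_alg[OF assms(1,2) finite_words words_subset finite_words words_subset assms(3)])

lemma tensor_map_words:
  assumes "linear_on (free_alg A) cscale \<phi>" "linear_on (free_alg A) cscale \<psi>" "supp t \<subseteq> words N \<times> words N"
  shows "tensor_map (free_alg A) (free_alg A) \<phi> \<psi> t (p, q)
    = (\<Sum>u\<in>words N. \<Sum>v\<in>words N. t (u, v) * (\<phi> (word u) p * \<psi> (word v) q))"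
  unfolding tensor_map_def
    tensor_lift_words[OF cfun.vector_space_axioms bilinear_on_tens[OF assms(1,2)] assms(3)]
  by (simp add: sum_fun_apply cscale_def tens_def)

lemma linear_id: "linear_on V cscale id"
  by (simp add: linear_on_def)

lemma comult_Nil: "\<Delta> (word []) (u, v) = (if u = [] \<and> v = [] then 1 else 0)"
proof -
  have "\<Delta> (word []) = tens (word []) (word [])"
    using bialgebra by (simp add: is_bialgebra_def conc_bialg_def)
  then show ?thesis by (simp add: tens_word_apply)
qed

text \<open>This is the coefficient of v in the counit axiom for w: the counit vanishes on nonempty
  words, so only the terms \<open>[] \<otimes> b\<close> of the coproduct survive.\<close>

lemma comult_Nil_left:
  assumes "w \<in> lists A"
  shows "\<Delta> (word w) ([], v) = (if v = w then 1 else 0)"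
proof -
  have w: "w \<in> words (wdeg w)" using assms by (simp add: words_def)
  let ?W = "words (wdeg w)"
  have "bilinear_on (free_alg A) (free_alg A) cscale (\<lambda>a b. cscale (\<epsilon> a) b)"
    using linear_counit by (auto simp: bilinear_on_def linear_on_def cscale_def fun_eq_iff algebra_simps)
  from tensor_lift_words[OF cfun.vector_space_axioms this supp_comult[OF w]]
  have "word w v = (\<Sum>a\<in>?W. \<Sum>b\<in>?W. cscale (\<Delta> (word w) (a, b)) (cscale (\<epsilon> (word a)) (word b))) v"
    using coalgebra word_in[OF w] by (simp add: is_coalgebra_def conc_bialg_def)
  also have "\<dots> = (\<Sum>a\<in>?W. \<Sum>b\<in>?W. if b = v then (if a = [] then \<Delta> (word w) (a, b) else 0) else 0)"
    unfolding sum_fun_apply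
    by (intro sum.cong refl) (auto simp: cscale_def counit_word[OF words_listsD] word_apply)
  also have "\<dots> = (if v \<in> ?W then \<Delta> (word w) ([], v) else 0)"
    by simp
  also have "\<dots> = \<Delta> (word w) ([], v)"
    using comult_in_words(2)[OF w] by auto
  finally show ?thesis by (simp add: word_apply)
qed

lemma comult_Nil_right:
  assumes "w \<in> lists A"
  shows "\<Delta> (word w) (u, []) = (if u = w then 1 else 0)"
proof -
  have w: "w \<in> words (wdeg w)" using assms by (simp add: words_def)
  let ?W = "words (wdeg w)"
  have "bilinear_on (free_alg A) (free_alg A) cscale (\<lambda>a b. cscale (\<epsilon> b) a)"
    using linear_counit by (auto simp: bilinear_on_def linear_on_def cscale_def fun_eq_iff algebra_simps)
  from tensor_lift_words[OF cfun.vector_space_axioms this supp_comult[OF w]]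
  have "word w u = (\<Sum>a\<in>?W. \<Sum>b\<in>?W. cscale (\<Delta> (word w) (a, b)) (cscale (\<epsilon> (word b)) (word a))) u"
    using coalgebra word_in[OF w] by (simp add: is_coalgebra_def conc_bialg_def)
  also have "\<dots> = (\<Sum>a\<in>?W. \<Sum>b\<in>?W. if b = [] then (if a = u then \<Delta> (word w) (a, b) else 0) else 0)"
    unfolding sum_fun_apply
    by (intro sum.cong refl) (auto simp: cscale_def counit_word[OF words_listsD] word_apply)
  also have "\<dots> = (if u \<in> ?W then \<Delta> (word w) (u, []) else 0)"
    by simp
  also have "\<dots> = \<Delta> (word w) (u, [])"
    using comult_in_words(1)[OF w] by auto
  finally show ?thesis by (simp add: word_apply)
qed

text \<open>The sides are the coefficients of \<open>x \<otimes> y \<otimes> z\<close> in the two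
  iterated coproducts of w.\<close>

lemma coassoc:
  assumes w: "w \<in> words N"
  shows "(\<Sum>p\<in>words N. \<Delta> (word w) (p, z) * \<Delta> (word p) (x, y))
    = (\<Sum>q\<in>words N. \<Delta> (word w) (x, q) * \<Delta> (word q) (y, z))" (is "?l = ?r")
proof -
  let ?W = "words N" and ?D = "\<lambda>w u v. \<Delta> (word w) (u, v)"
  \<comment> \<open>The extra index c makes the factor of the identity map explicit, as
    \<open>tensor_map_words\<close> expects.\<close>
  have "?l = (\<Sum>p\<in>?W. \<Sum>c\<in>?W. if c = z then ?D w p z * ?D p x y else 0)"
    using comult_in_words(2)[OF w, of _ z] by (intro sum.cong refl) auto
  also have "\<dots> = (\<Sum>p\<in>?W. \<Sum>c\<in>?W. ?D w p c * (?D p x y * id (word c) z))"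
    by (intro sum.cong refl) (auto simp: word_apply)
  also have "\<dots> = tensor_assoc (tensor_map (free_alg A) (free_alg A) \<Delta> id (\<Delta> (word w))) (x, y, z)"
    by (simp only: tensor_assoc_def prod.case tensor_map_words[OF linear_comult linear_id supp_comult[OF w]])
  also have "\<dots> = tensor_map (free_alg A) (free_alg A) id \<Delta> (\<Delta> (word w)) (x, y, z)"
    using coalgebra word_in[OF w] by (simp add: is_coalgebra_def conc_bialg_def)
  also have "\<dots> = (\<Sum>a\<in>?W. \<Sum>q\<in>?W. ?D w a q * (id (word a) x * ?D q y z))"
    by (simp only: tensor_map_words[OF linear_id linear_comult supp_comult[OF w]])
  also have "\<dots> = (\<Sum>q\<in>?W. \<Sum>a\<in>?W. if a = x then ?D w x q * ?D q y z else 0)"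
    by (subst sum.swap, intro sum.cong refl) (auto simp: word_apply)
  also have "\<dots> = ?r"
    using comult_in_words(1)[OF w, of x] by (intro sum.cong refl) auto
  finally show ?thesis .
qed

lemma comult_append_sum:
  assumes "w1 \<in> words N" "w2 \<in> words N"
  shows "\<Delta> (word (w1 @ w2)) (x, y) = (\<Sum>a\<in>words N. \<Sum>b\<in>words N. \<Sum>c\<in>words N. \<Sum>d\<in>words N.
    \<Delta> (word w1) (a, b) * \<Delta> (word w2) (c, d) * (if a @ c = x \<and> b @ d = y then 1 else 0))"
proof -
  let ?H = "conc_bialg A \<Delta> \<epsilon>"
  have "\<Delta> (conc (word w1) (word w2)) = tensor_mult ?H (\<Delta> (word w1)) (\<Delta> (word w2))"
    using bialgebra word_in[OF assms(1)] word_in[OF assms(2)]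
    by (simp add: is_bialgebra_def conc_bialg_def)
  moreover have "tensor_mult ?H (\<Delta> (word w1)) (\<Delta> (word w2)) (x, y) =
    (\<Sum>a\<in>words N. \<Sum>b\<in>words N. \<Sum>c\<in>words N. \<Sum>d\<in>words N. \<Delta> (word w1) (a, b) *
      (\<Delta> (word w2) (c, d) * (mlt ?H (word a) (word c) x * mlt ?H (word b) (word d) y)))"
    by (rule tensor_mult_free_alg[OF _ _ finite_words words_subset supp_comult[OF assms(1)]
          finite_words words_subset supp_comult[OF assms(2)]])
      (simp_all add: conc_bialg_def bilinear_conc)
  ultimately show ?thesis
    by (simp add: conc_word conc_bialg_def) (intro sum.cong refl, auto simp: word_apply)
qed

text \<open>Regrouping \<open>comult_append_sum\<close> along the factorizations of u1 and u2 frees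
  it from the bound N. Both the expansion of the cup product and the restriction to a subalphabet
  use this form.\<close>

lemma comult_append:
  assumes "w1 \<in> lists A" "w2 \<in> lists A"
  shows "\<Delta> (word (w1 @ w2)) (u1, u2) =
    (\<Sum>(p1, v1, p2, v2)\<in>{(p1, v1, p2, v2). u1 = p1 @ v1 \<and> u2 = p2 @ v2}.
      \<Delta> (word w1) (p1, p2) * \<Delta> (word w2) (v1, v2))" (is "_ = sum ?g ?S")
proof -
  define N where "N = wdeg w1 + wdeg w2"
  have w: "w1 \<in> words N" "w2 \<in> words N"
    using assms by (auto simp: words_def N_def)
  let ?W = "words N"
  let ?T = "{q \<in> ?W \<times> ?W \<times> ?W \<times> ?W. case q of (a, b, c, d) \<Rightarrow> a @ c = u1 \<and> b @ d = u2}"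
  let ?f = "\<lambda>(a, b, c, d). \<Delta> (word w1) (a, b) * \<Delta> (word w2) (c, d)"
  have "\<Delta> (word (w1 @ w2)) (u1, u2) = (\<Sum>q\<in>?W \<times> ?W \<times> ?W \<times> ?W. case q of (a, b, c, d) \<Rightarrow>
      \<Delta> (word w1) (a, b) * \<Delta> (word w2) (c, d) * (if a @ c = u1 \<and> b @ d = u2 then 1 else 0))"
    unfolding comult_append_sum[OF w] sum.cartesian_product[symmetric]
    by (simp add: sum.cartesian_product)
  also have "\<dots> = sum ?f ?T"
    by (rule sum.mono_neutral_cong_right) (auto split: if_splits)
  \<comment> \<open>The middle components trade places, from (p1, p2, v1, v2) to (p1, v1, p2,
    v2).\<close>
  also have "\<dots> = sum ?g {(a, c, b, d). (a, b, c, d) \<in> ?T}"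
    by (rule sum.reindex_bij_witness[of _ "\<lambda>(a, c, b, d). (a, b, c, d)" "\<lambda>(a, b, c, d). (a, c, b, d)"])
      auto
  also have "\<dots> = sum ?g ?S"
  \<comment> \<open>Factorizations with a part outside the truncation contribute 0.\<close>
  proof (rule sum.mono_neutral_left)
    show "\<forall>i\<in>?S - {(a, c, b, d). (a, b, c, d) \<in> ?T}. ?g i = 0"
      using comult_in_words[OF w(1)] comult_in_words[OF w(2)] by auto
    show "finite ?S" by (rule finite_double_splits)
  qed auto
  finally show ?thesis .
qed

subsection \<open>The transposed bialgebra\<close>

abbreviation dual_mult :: "('a list \<Rightarrow> complex) \<Rightarrow> ('a list \<Rightarrow> complex) \<Rightarrow> 'a list \<Rightarrow> complex"  (infixl \<open>\<diamondop>\<close> 70)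
  where "x \<diamondop> y \<equiv> cup A \<Delta> x y"

lemma cup_outside: "w \<notin> lists A \<Longrightarrow> (x \<diamondop> y) w = 0"
  by (simp add: cup_def)

lemma cup_eq_sum:
  assumes "x \<in> free_alg A" "y \<in> free_alg A" "w \<in> words N"
  shows "(x \<diamondop> y) w = (\<Sum>u\<in>words N. \<Sum>v\<in>words N. x u * y v * \<Delta> (word w) (u, v))"
proof -
  have "supp (tens x y) = supp x \<times> supp y"
    by (auto simp: tens_def)
  then have "finite (supp (tens x y))"
    using assms(1,2) by (simp add: free_alg_iff)
  then have "pairing (tens x y) (\<Delta> (word w)) = (\<Sum>p\<in>words N \<times> words N. tens x y p * \<Delta> (word w) p)"
    by (rule pairing_eq_sum) (use supp_comult[OF assms(3)] in simp_all)
  then show ?thesis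
    using assms(3) by (simp add: cup_def words_def sum.cartesian_product tens_def case_prod_beta)
qed

lemma cup_word: "(word u \<diamondop> word v) w = (if w \<in> lists A then \<Delta> (word w) (u, v) else 0)"
  by (simp add: cup_def pairing_word)

text \<open>Degrees add under the product because the coproduct preserves them. This bound makes the
  product finitely supported, hence an element of the free algebra.\<close>

lemma supp_cup:
  assumes "x \<in> free_alg A" "y \<in> free_alg A" "supp x \<subseteq> words M" "supp y \<subseteq> words N"
  shows "supp (x \<diamondop> y) \<subseteq> words (M + N)"
proof
  fix w assume "w \<in> supp (x \<diamondop> y)"
  then have nz: "(x \<diamondop> y) w \<noteq> 0" by simp
  then have w: "w \<in> lists A" using cup_outside by blast
  then have "(\<Sum>u\<in>words (wdeg w). \<Sum>v\<in>words (wdeg w). x u * y v * \<Delta> (word w) (u, v)) \<noteq> 0"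
    using nz cup_eq_sum[OF assms(1,2), of w "wdeg w"] by (simp add: words_def)
  then obtain u where "(\<Sum>v\<in>words (wdeg w). x u * y v * \<Delta> (word w) (u, v)) \<noteq> 0"
    by (meson sum.neutral)
  then obtain v where uv: "x u * y v * \<Delta> (word w) (u, v) \<noteq> 0"
    by (meson sum.neutral)
  then have "u \<in> words M" "v \<in> words N" "wdeg u + wdeg v = wdeg w"
    using assms(3,4) homogeneous[OF w, of u v] by auto
  then show "w \<in> words (M + N)"
    using w by (auto simp: words_def)
qed

lemma free_alg_wordsI: "supp x \<subseteq> words N \<Longrightarrow> x \<in> free_alg A"
  unfolding free_alg_iff by (rule conjI[OF finite_subset[OF _ finite_words] order_trans[OF _ words_subset]])

lemma cup_in:
  assumes "x \<in> free_alg A" "y \<in> free_alg A"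
  shows "x \<diamondop> y \<in> free_alg A"
proof -
  obtain M N where "supp x \<subseteq> words M" "supp y \<subseteq> words N"
    using supp_subset_words[OF assms(1)] supp_subset_words[OF assms(2)] .
  from free_alg_wordsI[OF supp_cup[OF assms this]] show ?thesis .
qed

text \<open>Truncated at the degree of the word considered, each coefficient is a finite sum
  bilinear in the arguments. Words outside \<open>lists A\<close> are treated apart because
  \<open>cup\<close> is cut off there.\<close>

lemma bilinear_cup: "bilinear_on (free_alg A) (free_alg A) cscale (cup A \<Delta>)"
proof -
  have pointwise: "F = G" if "\<And>w. w \<in> lists A \<Longrightarrow> F w = G w" "\<And>w. w \<notin> lists A \<Longrightarrow> F w = G w"
    for F G :: "'a list \<Rightarrow> complex" using that by blast
  note V = cfun.subspace_add[OF subspace_free_alg] cfun.subspace_scale[OF subspace_free_alg]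
  have "(x + y) \<diamondop> z = x \<diamondop> z + y \<diamondop> z"
    if "x \<in> free_alg A" "y \<in> free_alg A" "z \<in> free_alg A" for x y z
    by (rule pointwise)
      (use that in \<open>simp_all add: cup_outside cup_eq_sum[OF _ _ self_in_words[OF _ order_refl]] V
        cscale_apply sum_distrib_left sum.distrib[symmetric] algebra_simps\<close>)
  moreover have "z \<diamondop> (x + y) = z \<diamondop> x + z \<diamondop> y"
    if "x \<in> free_alg A" "y \<in> free_alg A" "z \<in> free_alg A" for x y z
    by (rule pointwise)
      (use that in \<open>simp_all add: cup_outside cup_eq_sum[OF _ _ self_in_words[OF _ order_refl]] V
        cscale_apply sum_distrib_left sum.distrib[symmetric] algebra_simps\<close>)
  moreover have "cscale c x \<diamondop> z = cscale c (x \<diamondop> z)"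
    if "x \<in> free_alg A" "z \<in> free_alg A" for x z c
    by (rule pointwise)
      (use that in \<open>simp_all add: cup_outside cup_eq_sum[OF _ _ self_in_words[OF _ order_refl]] V
        cscale_apply sum_distrib_left sum.distrib[symmetric] algebra_simps\<close>)
  moreover have "z \<diamondop> cscale c x = cscale c (z \<diamondop> x)"
    if "x \<in> free_alg A" "z \<in> free_alg A" for x z c
    by (rule pointwise)
      (use that in \<open>simp_all add: cup_outside cup_eq_sum[OF _ _ self_in_words[OF _ order_refl]] V
        cscale_apply sum_distrib_left sum.distrib[symmetric] algebra_simps\<close>)
  ultimately show ?thesis by (simp add: bilinear_on_def linear_on_def)
qed

text \<open>After both products are expanded and the scalars pulled out, the coefficient of w is a
  sum over a, b, c in which the innermost sum is one side of \<open>coassoc\<close>.\<close>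

lemma cup_assoc:
  assumes "x \<in> free_alg A" "y \<in> free_alg A" "z \<in> free_alg A"
  shows "(x \<diamondop> y) \<diamondop> z = x \<diamondop> (y \<diamondop> z)"
proof
  fix w
  show "((x \<diamondop> y) \<diamondop> z) w = (x \<diamondop> (y \<diamondop> z)) w"
  proof (cases "w \<in> lists A")
    case True
    define W where "W = words (wdeg w)"
    have w: "w \<in> words (wdeg w)" using True by (simp add: words_def)
    let ?D = "\<lambda>w u v. \<Delta> (word w) (u, v)"
    have "((x \<diamondop> y) \<diamondop> z) w = (\<Sum>p\<in>W. \<Sum>c\<in>W. (x \<diamondop> y) p * z c * ?D w p c)"
      unfolding W_def by (rule cup_eq_sum[OF cup_in[OF assms(1,2)] assms(3) w])
    also have "\<dots> = (\<Sum>p\<in>W. \<Sum>c\<in>W. (\<Sum>a\<in>W. \<Sum>b\<in>W. x a * y b * ?D p a b) * z c * ?D w p c)"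
      by (intro sum.cong refl) (simp add: W_def cup_eq_sum[OF assms(1,2)])
    also have "\<dots> = (\<Sum>p\<in>W. \<Sum>c\<in>W. \<Sum>a\<in>W. \<Sum>b\<in>W. x a * y b * z c * (?D w p c * ?D p a b))"
      by (simp add: sum_distrib_left sum_distrib_right mult_ac)
    also have "\<dots> = (\<Sum>p\<in>W. \<Sum>a\<in>W. \<Sum>b\<in>W. \<Sum>c\<in>W. x a * y b * z c * (?D w p c * ?D p a b))"
      by (rule sum.cong[OF refl]) (rule sum_rotate)
    also have "\<dots> = (\<Sum>a\<in>W. \<Sum>b\<in>W. \<Sum>c\<in>W. \<Sum>p\<in>W. x a * y b * z c * (?D w p c * ?D p a b))"
      by (rule trans[OF sum.swap], rule sum.cong[OF refl]) (rule sum_rotate)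
    also have "\<dots> = (\<Sum>a\<in>W. \<Sum>b\<in>W. \<Sum>c\<in>W. \<Sum>q\<in>W. x a * y b * z c * (?D w a q * ?D q b c))"
      by (simp only: sum_distrib_left[symmetric] coassoc[OF w, folded W_def])
    also have "\<dots> = (\<Sum>a\<in>W. \<Sum>q\<in>W. \<Sum>b\<in>W. \<Sum>c\<in>W. x a * y b * z c * (?D w a q * ?D q b c))"
      by (rule sum.cong[OF refl]) (rule sum_rotate[symmetric])
    also have "\<dots> = (\<Sum>a\<in>W. \<Sum>q\<in>W. x a * (\<Sum>b\<in>W. \<Sum>c\<in>W. y b * z c * ?D q b c) * ?D w a q)"
      by (simp add: sum_distrib_left sum_distrib_right mult_ac)
    also have "\<dots> = (\<Sum>a\<in>W. \<Sum>q\<in>W. x a * (y \<diamondop> z) q * ?D w a q)"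
      by (intro sum.cong refl) (simp add: W_def cup_eq_sum[OF assms(2,3)])
    also have "\<dots> = (x \<diamondop> (y \<diamondop> z)) w"
      unfolding W_def by (rule cup_eq_sum[OF assms(1) cup_in[OF assms(2,3)] w, symmetric])
    finally show ?thesis .
  qed (simp add: cup_outside)
qed

lemma unit_in: "word [] \<in> free_alg A"
  by (rule word_in_free_alg) simp

lemma cup_unit:
  assumes "x \<in> free_alg A"
  shows "word [] \<diamondop> x = x" "x \<diamondop> word [] = x"
proof -
  have "(word [] \<diamondop> x) w = x w \<and> (x \<diamondop> word []) w = x w" for w
  proof (cases "w \<in> lists A")
    case True
    then have w: "w \<in> words (wdeg w)" by (simp add: words_def)
    have "(word [] \<diamondop> x) w = (\<Sum>u\<in>words (wdeg w). \<Sum>v\<in>words (wdeg w). if u = [] \<and> v = w then x v else 0)"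
      unfolding cup_eq_sum[OF unit_in assms w]
      by (intro sum.cong refl) (simp add: word_apply comult_Nil_left[OF True])
    moreover have "(x \<diamondop> word []) w = (\<Sum>u\<in>words (wdeg w). \<Sum>v\<in>words (wdeg w). if u = w \<and> v = [] then x u else 0)"
      unfolding cup_eq_sum[OF assms unit_in w]
      by (intro sum.cong refl) (simp add: word_apply comult_Nil_right[OF True])
    ultimately show ?thesis
      using w by (subst (asm) (1 2) sum_pair_delta) simp_all
  next
    case False
    then have "x w = 0" using assms by (auto simp: free_alg_iff subset_iff)
    with False show ?thesis by (simp add: cup_outside)
  qed
  then show "word [] \<diamondop> x = x" "x \<diamondop> word [] = x" by (auto simp: fun_eq_iff)
qed

lemma is_algebra_cup: "is_algebra (cup_bialg A \<Delta>)"
  unfolding is_algebra_def cup_bialg_def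
  by (simp add: subspace_free_alg cup_in bilinear_cup cup_assoc unit_in cup_unit)

section \<open>Deconcatenation and its compatibility with the product\<close>

lemma finite_supp_free_alg: "x \<in> free_alg A \<Longrightarrow> finite (supp x)"
  by (simp add: free_alg_iff)

lemma deconc_words: "supp x \<subseteq> words N \<Longrightarrow> deconc x (u, v) = x (u @ v)"
  by (rule deconc_apply) (rule finite_subset[OF _ finite_words])

lemma supp_deconc:
  assumes "supp x \<subseteq> words N"
  shows "supp (deconc x) \<subseteq> words N \<times> words N"
proof clarify
  fix u v assume "(u, v) \<in> supp (deconc x)"
  then have "u @ v \<in> words N"
    using assms by (auto simp: deconc_words[OF assms])
  then show "u \<in> words N \<and> v \<in> words N" using append_in_wordsD by blast
qed

lemma linear_deconc: "linear_on (free_alg A) cscale deconc"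
  unfolding deconc_def by (rule linear_on_extend_linearly)

lemma is_coalgebra_cup: "is_coalgebra (cup_bialg A \<Delta>)"
proof -
  let ?V = "free_alg A"
  have 1: "deconc x \<in> tensor_space ?V ?V" if x: "x \<in> ?V" for x
  proof -
    obtain N where N: "supp x \<subseteq> words N" using supp_subset_words[OF x] .
    have "finite (supp (deconc x))"
      by (rule finite_subset[OF supp_deconc[OF N]]) simp
    moreover have "supp (deconc x) \<subseteq> lists A \<times> lists A"
      using supp_deconc[OF N] words_subset[of N] by (meson Sigma_mono subset_trans)
    ultimately show ?thesis by (simp add: tensor_space_free_alg)
  qed
  have 2: "linear_on ?V (*) (\<lambda>x. x [])"
    by (simp add: linear_on_def cscale_def)
  \<comment> \<open>At (u, v, w) both sides take the value \<open>x (u @ v @ w)\<close>.\<close>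
  have 3: "tensor_assoc (tensor_map ?V ?V deconc id (deconc x)) = tensor_map ?V ?V id deconc (deconc x)"
    if x: "x \<in> ?V" for x
  proof
    fix p :: "'a list \<times> 'a list \<times> 'a list"
    obtain u v w where p: "p = (u, v, w)" by (cases p)
    obtain N where N: "supp x \<subseteq> words N" using supp_subset_words[OF x] .
    note d = deconc_apply[OF finite_supp_free_alg[OF word_in_free_alg]]
    \<comment> \<open>If this value is nonzero, all words tested lie in the truncation; if it is 0,
      \<open>sum_pair_delta\<close> accepts them out of range.\<close>
    have nz: "u @ v \<in> words N \<and> v @ w \<in> words N \<and> u \<in> words N \<and> w \<in> words N" if "x (u @ v @ w) \<noteq> 0"
      using that N by (auto simp: words_def)
    have "tensor_assoc (tensor_map ?V ?V deconc id (deconc x)) p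
        = (\<Sum>a\<in>words N. \<Sum>c\<in>words N. deconc x (a, c) * (deconc (word a) (u, v) * id (word c) w))"
      by (simp only: p tensor_assoc_def prod.case tensor_map_words[OF linear_deconc linear_id supp_deconc[OF N]])
    also have "\<dots> = (\<Sum>a\<in>words N. \<Sum>c\<in>words N. if a = u @ v \<and> c = w then x (a @ c) else 0)"
      by (intro sum.cong refl) (auto simp: deconc_words[OF N] d[OF words_listsD] word_apply)
    also have "\<dots> = x (u @ v @ w)"
      by (subst sum_pair_delta) (use nz in auto)
    also have "\<dots> = (\<Sum>a\<in>words N. \<Sum>c\<in>words N. if a = u \<and> c = v @ w then x (a @ c) else 0)"
      by (subst sum_pair_delta) (use nz in auto)
    also have "\<dots> = (\<Sum>a\<in>words N. \<Sum>c\<in>words N. deconc x (a, c) * (id (word a) u * deconc (word c) (v, w)))"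
      by (intro sum.cong refl) (auto simp: deconc_words[OF N] d[OF words_listsD] word_apply)
    also have "\<dots> = tensor_map ?V ?V id deconc (deconc x) p"
      by (simp only: p tensor_map_words[OF linear_id linear_deconc supp_deconc[OF N]])
    finally show "tensor_assoc (tensor_map ?V ?V deconc id (deconc x)) p = tensor_map ?V ?V id deconc (deconc x) p" .
  qed
  have 4: "tensor_lift cscale ?V ?V (\<lambda>a. cscale (a [])) (deconc x) = x"
    "tensor_lift cscale ?V ?V (\<lambda>a b. cscale (b []) a) (deconc x) = x"
    if x: "x \<in> ?V" for x
  proof -
    obtain N where N: "supp x \<subseteq> words N" using supp_subset_words[OF x] .
    have b: "bilinear_on ?V ?V cscale (\<lambda>a. cscale (a []))" "bilinear_on ?V ?V cscale (\<lambda>a b. cscale (b []) a)"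
      by (auto simp: bilinear_on_def linear_on_def cscale_def fun_eq_iff algebra_simps)
    have z: "x w = 0" if "w \<notin> words N" for w using that N by auto
    show "tensor_lift cscale ?V ?V (\<lambda>a. cscale (a [])) (deconc x) = x"
    proof
      fix w
      have "tensor_lift cscale ?V ?V (\<lambda>a. cscale (a [])) (deconc x) w
          = (\<Sum>u\<in>words N. \<Sum>v\<in>words N. if u = [] \<and> v = w then x (u @ v) else 0)"
        unfolding tensor_lift_words[OF cfun.vector_space_axioms b(1) supp_deconc[OF N]] sum_fun_apply
        by (intro sum.cong refl) (simp add: cscale_def deconc_words[OF N] word_apply)
      then show "tensor_lift cscale ?V ?V (\<lambda>a. cscale (a [])) (deconc x) w = x w"
        by (subst (asm) sum_pair_delta) (simp_all add: z)
    qed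
    show "tensor_lift cscale ?V ?V (\<lambda>a b. cscale (b []) a) (deconc x) = x"
    proof
      fix w
      have "tensor_lift cscale ?V ?V (\<lambda>a b. cscale (b []) a) (deconc x) w
          = (\<Sum>u\<in>words N. \<Sum>v\<in>words N. if u = w \<and> v = [] then x (u @ v) else 0)"
        unfolding tensor_lift_words[OF cfun.vector_space_axioms b(2) supp_deconc[OF N]] sum_fun_apply
        by (intro sum.cong refl) (simp add: cscale_def deconc_words[OF N] word_apply)
      then show "tensor_lift cscale ?V ?V (\<lambda>a b. cscale (b []) a) (deconc x) w = x w"
        by (subst (asm) sum_pair_delta) (simp_all add: z)
    qed
  qed
  show ?thesis
    unfolding is_coalgebra_def cup_bialg_def
    by (simp add: subspace_free_alg linear_deconc 1 2 3 4)
qed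

text \<open>Transposed multiplicativity of \<Delta>: the left side is the coefficient of
  \<open>u \<otimes> v\<close> in the deconcatenation of the product.\<close>

lemma cup_append:
  assumes x: "x \<in> free_alg A" "supp x \<subseteq> words N" and y: "y \<in> free_alg A" "supp y \<subseteq> words N"
    and uv: "u \<in> words N" "v \<in> words N"
  shows "(x \<diamondop> y) (u @ v) = (\<Sum>a\<in>words N. \<Sum>b\<in>words N. \<Sum>c\<in>words N. \<Sum>d\<in>words N.
    \<Delta> (word u) (a, b) * \<Delta> (word v) (c, d) * (x (a @ c) * y (b @ d)))"
proof -
  define W where "W = words N"
  \<comment> \<open>The words \<open>a @ c\<close> and \<open>b @ d\<close> can have degree up to N
    + N, so the product is expanded over a larger truncation than the one for a, b, c, d.\<close>
  define P where "P = words (N + N)"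
  let ?g = "\<lambda>(a, b, c, d). \<Delta> (word u) (a, b) * \<Delta> (word v) (c, d)"
  let ?h = "\<lambda>(a, b, c, d). a @ c" and ?k = "\<lambda>(a, b, c, d). b @ d"
  let ?Q = "W \<times> W \<times> W \<times> W"
  have Q: "?h t \<in> P" "?k t \<in> P" if "t \<in> ?Q" for t
    using that by (auto simp: P_def W_def intro: append_in_words)
  have D: "\<Delta> (word (u @ v)) (p, q) = (\<Sum>t\<in>?Q. ?g t * (if p = ?h t \<and> q = ?k t then 1 else 0))" for p q
    unfolding comult_append_sum[OF uv, folded W_def] sum.cartesian_product
    by (intro sum.cong refl) auto
  have "(x \<diamondop> y) (u @ v) = (\<Sum>p\<in>P. \<Sum>q\<in>P. x p * y q * \<Delta> (word (u @ v)) (p, q))"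
    unfolding P_def by (rule cup_eq_sum[OF x(1) y(1) append_in_words[OF uv]])
  also have "\<dots> = (\<Sum>p\<in>P. \<Sum>q\<in>P. \<Sum>t\<in>?Q. if p = ?h t \<and> q = ?k t then ?g t * (x p * y q) else 0)"
    unfolding D sum_distrib_left by (intro sum.cong refl) simp
  also have "\<dots> = (\<Sum>t\<in>?Q. \<Sum>p\<in>P. \<Sum>q\<in>P. if p = ?h t \<and> q = ?k t then ?g t * (x p * y q) else 0)"
    by (rule sum_rotate[symmetric])
  also have "\<dots> = (\<Sum>t\<in>?Q. ?g t * (x (?h t) * y (?k t)))"
  proof (rule sum.cong[OF refl])
    fix t assume "t \<in> ?Q"
    note Q[OF this]
    then show "(\<Sum>p\<in>P. \<Sum>q\<in>P. if p = ?h t \<and> q = ?k t then ?g t * (x p * y q) else 0)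
        = ?g t * (x (?h t) * y (?k t))"
      by (intro sum_pair_delta[of P P "?h t" "?k t" "\<lambda>p q. ?g t * (x p * y q)"])
        (simp_all only: P_def finite_words simp_thms)
  qed
  also have "\<dots> = (\<Sum>a\<in>W. \<Sum>b\<in>W. \<Sum>c\<in>W. \<Sum>d\<in>W.
      \<Delta> (word u) (a, b) * \<Delta> (word v) (c, d) * (x (a @ c) * y (b @ d)))"
    by (simp add: sum.cartesian_product case_prod_unfold)
  finally show ?thesis unfolding W_def .
qed

lemma deconc_cup:
  assumes x: "x \<in> free_alg A" and y: "y \<in> free_alg A"
  shows "deconc (x \<diamondop> y) = tensor_mult (cup_bialg A \<Delta>) (deconc x) (deconc y)"
proof
  fix p :: "'a list \<times> 'a list"
  obtain u v where p: "p = (u, v)" by (cases p)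
  \<comment> \<open>N also has to cover \<open>u @ v\<close>, but only if that is a word over
    A.\<close>
  obtain N where N: "supp x \<union> supp y \<union> (if u @ v \<in> lists A then {u @ v} else {}) \<subseteq> words N"
    by (rule finite_subset_words[of "supp x \<union> supp y \<union> (if u @ v \<in> lists A then {u @ v} else {})"])
      (use x y in \<open>auto simp: free_alg_iff\<close>)
  then have sx: "supp x \<subseteq> words N" and sy: "supp y \<subseteq> words N" by auto
  let ?H = "cup_bialg A \<Delta>" and ?W = "words N"
  have R: "tensor_mult ?H (deconc x) (deconc y) p = (\<Sum>a\<in>?W. \<Sum>c\<in>?W. \<Sum>b\<in>?W. \<Sum>d\<in>?W.
      deconc x (a, c) * (deconc y (b, d) * (mlt ?H (word a) (word b) u * mlt ?H (word c) (word d) v)))"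
    unfolding p
    by (rule tensor_mult_free_alg[OF _ _ finite_words words_subset supp_deconc[OF sx]
          finite_words words_subset supp_deconc[OF sy]])
      (simp_all add: cup_bialg_def bilinear_cup)
  have L: "deconc (x \<diamondop> y) p = (x \<diamondop> y) (u @ v)"
    unfolding p by (rule deconc_apply[OF finite_supp_free_alg[OF cup_in[OF x y]]])
  show "deconc (x \<diamondop> y) p = tensor_mult ?H (deconc x) (deconc y) p"
  proof (cases "u @ v \<in> lists A")
    case True
    then have "u @ v \<in> ?W" using N by (simp del: append_in_lists_conv)
    then have uv: "u \<in> ?W" "v \<in> ?W" using append_in_wordsD by blast+
    have "(x \<diamondop> y) (u @ v) = (\<Sum>a\<in>?W. \<Sum>b\<in>?W. \<Sum>c\<in>?W. \<Sum>d\<in>?W.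
      \<Delta> (word u) (a, b) * \<Delta> (word v) (c, d) * (x (a @ c) * y (b @ d)))"
      by (rule cup_append[OF x sx y sy uv])
    \<comment> \<open>\<open>tensor_mult\<close> splits x into a, c before it splits y into b, d;
      the coproducts of u and v pair a with b and c with d.\<close>
    also have "\<dots> = (\<Sum>a\<in>?W. \<Sum>c\<in>?W. \<Sum>b\<in>?W. \<Sum>d\<in>?W.
      \<Delta> (word u) (a, b) * \<Delta> (word v) (c, d) * (x (a @ c) * y (b @ d)))"
      by (rule sum.cong[OF refl]) (rule sum.swap)
    also have "\<dots> = tensor_mult ?H (deconc x) (deconc y) p"
      unfolding R using words_listsD[OF uv(1)] words_listsD[OF uv(2)]
      by (simp add: cup_bialg_def cup_word deconc_words[OF sx] deconc_words[OF sy] mult_ac)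
    finally show ?thesis unfolding L .
  next
    \<comment> \<open>One of u and v is not a word over A, and every cup product vanishes
      there.\<close>
    case False
    then have z: "mlt ?H (word a) (word b) u * mlt ?H (word c) (word d) v = 0" for a b c d
      by (auto simp: cup_bialg_def cup_word)
    have "tensor_mult ?H (deconc x) (deconc y) p = 0"
      unfolding R by (simp only: z mult_zero_right sum.neutral_const)
    with False show ?thesis unfolding L by (simp add: cup_outside del: append_in_lists_conv)
  qed
qed

lemma is_bialgebra_cup: "is_bialgebra (cup_bialg A \<Delta>)"
proof -
  have "deconc (word []) = tens (word []) (word ([] :: 'a list))"
    by (auto simp: fun_eq_iff deconc_apply[OF finite_supp_free_alg[OF unit_in]] tens_word_apply word_apply)
  \<comment> \<open>Multiplicativity of the counit is the transpose of
    \<open>\<Delta> 1 = 1 \<otimes> 1\<close>.\<close>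
  moreover have "(x \<diamondop> y) [] = x [] * y []" if "x \<in> free_alg A" "y \<in> free_alg A" for x y
  proof -
    have "(x \<diamondop> y) [] = (\<Sum>u\<in>words 0. \<Sum>v\<in>words 0. if u = [] \<and> v = [] then x u * y v else 0)"
      unfolding cup_eq_sum[OF that Nil_in_words[of 0]] by (intro sum.cong refl) (simp add: comult_Nil)
    then show ?thesis by (subst (asm) sum_pair_delta) simp_all
  qed
  ultimately show ?thesis
    unfolding is_bialgebra_def using is_algebra_cup is_coalgebra_cup deconc_cup
    by (simp add: cup_bialg_def word_apply)
qed

text \<open>These rules unfold membership in \<open>lists A\<close> to a statement about the letters.\<close>

declare in_listsD [rule del] in_listsI [rule del]

text \<open>The term \<open>p1 = p2 = 1\<close> of the expansion drops out because \<open>(1 \<otimes> 1, \<Delta> a) = 0\<close> for a letter \<open>a\<close>.\<close>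

lemma cup_recursion:
  assumes u: "u1 \<noteq> [] \<or> u2 \<noteq> []"
  shows "word u1 \<diamondop> word u2 =
    (\<Sum>(p1, v1, p2, v2)\<in>{(p1, v1, p2, v2). u1 = p1 @ v1 \<and> u2 = p2 @ v2 \<and> (p1 \<noteq> [] \<or> p2 \<noteq> [])}.
      \<Sum>a\<in>{a\<in>A. \<Delta> (word [a]) (p1, p2) \<noteq> 0}.
        cscale (\<Delta> (word [a]) (p1, p2)) (conc (word [a]) (word v1 \<diamondop> word v2)))" (is "_ = sum ?g ?S")
proof
  fix w
  let ?A = "\<lambda>p1 p2. {a\<in>A. \<Delta> (word [a]) (p1, p2) \<noteq> 0}"
  \<comment> \<open>Homogeneity confines the letters to a single degree, so the sum is finite even
    over an infinite alphabet.\<close>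
  have fin: "finite (?A p1 p2)" for p1 p2
  proof (rule finite_subset)
    show "?A p1 p2 \<subseteq> {a\<in>A. deg a = wdeg p1 + wdeg p2}"
      using homogeneous[of "[_]" p1 p2] by fastforce
    show "finite {a\<in>A. deg a = wdeg p1 + wdeg p2}"
      using alphabet by (simp add: graded_alphabet_def)
  qed
  have conc: "conc (word [a]) (word v1 \<diamondop> word v2) w
      = (if w \<noteq> [] \<and> hd w = a then (word v1 \<diamondop> word v2) (tl w) else 0)" for a v1 v2
  proof (rule conc_letter_apply)
    have "supp (word v1 \<diamondop> word v2) \<subseteq> words (wdeg v1 + wdeg v2)"
      using homogeneous[of _ v1 v2] by (auto simp: cup_word words_def split: if_splits)
    then show "finite (supp (word v1 \<diamondop> word v2))" by (rule finite_subset) simp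
  qed
  show "(word u1 \<diamondop> word u2) w = sum ?g ?S w"
  proof (cases w)
    \<comment> \<open>Both sides vanish: the left one because
      \<open>\<Delta> 1 = 1 \<otimes> 1\<close> and u1 or u2 is nonempty, the right one because
      every term starts with a letter.\<close>
    case Nil
    then show ?thesis
      using u by (auto simp: cup_word comult_Nil sum_fun_apply conc[unfolded Nil] cscale_apply case_prod_unfold)
  next
    case (Cons b w')
    have c: "conc (word [a]) (word v1 \<diamondop> word v2) w = (if a = b then (word v1 \<diamondop> word v2) w' else 0)" for a v1 v2
      unfolding conc by (auto simp: Cons)
    have "sum ?g ?S w = (\<Sum>(p1, v1, p2, v2)\<in>?S. \<Sum>a\<in>?A p1 p2. if a = b then \<Delta> (word [b]) (p1, p2) * (word v1 \<diamondop> word v2) w' else 0)"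
      unfolding sum_fun_apply case_prod_unfold by (intro sum.cong refl) (auto simp: cscale_apply c)
    also have "\<dots> = (\<Sum>(p1, v1, p2, v2)\<in>?S. if w \<in> lists A then \<Delta> (word [b]) (p1, p2) * \<Delta> (word w') (v1, v2) else 0)"
      using fin by (intro sum.cong refl) (auto simp: cup_word Cons)
    also have "\<dots> = (word u1 \<diamondop> word u2) w"
    proof (cases "w \<in> lists A")
      case True
      then have b: "[b] \<in> lists A" "w' \<in> lists A" by (simp_all add: Cons)
      have "\<Delta> (word ([b] @ w')) (u1, u2) = (\<Sum>(p1, v1, p2, v2)\<in>?S. \<Delta> (word [b]) (p1, p2) * \<Delta> (word w') (v1, v2))"
        unfolding comult_append[OF b]
        by (rule sum.mono_neutral_right[OF finite_double_splits])
          (use comult_Nil_left[OF b(1)] in auto)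
      then show ?thesis using True by (simp add: cup_word Cons)
    qed (simp add: cup_outside)
    finally show ?thesis ..
  qed
qed

subsection \<open>The antipode\<close>

text \<open>\<open>tensor_lift_words\<close> would sum over independent pairs. Grouping the terms by
  \<open>u @ v\<close> instead makes the inner sum a convolution.\<close>

lemma tensor_lift_deconc:
  assumes B: "bilinear_on (free_alg A) (free_alg A) cscale B" and x: "supp x \<subseteq> words N"
  shows "tensor_lift cscale (free_alg A) (free_alg A) B (deconc x)
    = (\<Sum>w\<in>words N. cscale (x w) (\<Sum>(u, v)\<in>{(u, v). u @ v = w}. B (word u) (word v)))"
proof -
  let ?V = "free_alg A" and ?F = "tensor_lift cscale (free_alg A) (free_alg A) B"
  let ?d = "\<lambda>w. \<Sum>(u, v)\<in>{(u, v). u @ v = w}. tens (word u) (word v)"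
  note lift = tensor_lift[OF cfun.vector_space_axioms subspace_free_alg subspace_free_alg B]
  have mem: "tens (word u) (word v) \<in> tensor_space ?V ?V" if "u @ v \<in> words N" for u v
    using append_in_wordsD[OF that] by (intro tens_in_tensor_space word_in)
  have d: "?d w \<in> tensor_space ?V ?V" if "w \<in> words N" for w
    using mem that by (intro cfun.subspace_sum[OF subspace_tensor_space]) auto
  have "?F (deconc x) = ?F (\<Sum>w\<in>words N. cscale (x w) (?d w))"
    unfolding deconc_def extend_linearly_eq[OF finite_words x] ..
  also have "\<dots> = (\<Sum>w\<in>words N. ?F (cscale (x w) (?d w)))"
    by (rule linear_on_sum[OF lift(1) subspace_tensor_space _ cfun.vector_space_axioms])
      (rule cfun.subspace_scale[OF subspace_tensor_space d])
  also have "\<dots> = (\<Sum>w\<in>words N. cscale (x w) (\<Sum>(u, v)\<in>{(u, v). u @ v = w}. B (word u) (word v)))"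
  proof (rule sum.cong[OF refl])
    fix w assume w: "w \<in> words N"
    have "?F (?d w) = (\<Sum>p\<in>{(u, v). u @ v = w}. ?F (case p of (u, v) \<Rightarrow> tens (word u) (word v)))"
      by (rule linear_on_sum[OF lift(1) subspace_tensor_space _ cfun.vector_space_axioms])
        (use mem w in auto)
    also have "\<dots> = (\<Sum>(u, v)\<in>{(u, v). u @ v = w}. B (word u) (word v))"
    proof (rule sum.cong[OF refl], clarify)
      fix u v assume "w = u @ v"
      then have "word u \<in> ?V" "word v \<in> ?V"
        using append_in_wordsD[of u v N] w word_in by blast+
      then show "?F (tens (word u) (word v)) = B (word u) (word v)" by (rule lift(2))
    qed
    finally show "?F (cscale (x w) (?d w)) = cscale (x w) (\<Sum>(u, v)\<in>{(u, v). u @ v = w}. B (word u) (word v))"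
      using lift(1) d[OF w] by (simp add: linear_on_def)
  qed
  finally show ?thesis .
qed

text \<open>Convolution product of linear endomorphisms for the coproduct \<open>deconc\<close> and
  the product \<open>cup\<close>, an endomorphism being encoded by its values on words.\<close>

definition conv :: "('a list \<Rightarrow> 'a list \<Rightarrow> complex) \<Rightarrow> ('a list \<Rightarrow> 'a list \<Rightarrow> complex) \<Rightarrow> 'a list \<Rightarrow> 'a list \<Rightarrow> complex"
  where "conv f g w = (\<Sum>(u, v)\<in>{(u, v). u @ v = w}. f u \<diamondop> g v)"

text \<open>Unit composed with counit, the neutral element of convolution.\<close>

definition conv_unit :: "'a list \<Rightarrow> 'a list \<Rightarrow> complex"
  where "conv_unit w = (if w = [] then word [] else 0)"

lemma splits_cases:
  assumes "p \<in> {(u, v). u @ v = w}" "w \<in> lists A"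
  obtains u v where "p = (u, v)" "w = u @ v" "u \<in> lists A" "v \<in> lists A"
  using assms by (cases p) (simp, metis append_in_lists_conv)

lemma conv_cong:
  assumes "\<And>w. w \<in> lists A \<Longrightarrow> f w = f' w" "\<And>w. w \<in> lists A \<Longrightarrow> g w = g' w" "w \<in> lists A"
  shows "conv f g w = conv f' g' w"
  unfolding conv_def
proof (rule sum.cong[OF refl])
  fix p assume "p \<in> {(u, v). u @ v = w}"
  then show "(case p of (u, v) \<Rightarrow> f u \<diamondop> g v) = (case p of (u, v) \<Rightarrow> f' u \<diamondop> g' v)"
    by (rule splits_cases[OF _ assms(3)]) (simp only: assms(1,2) prod.case)
qed

lemma linear_cup_left: "y \<in> free_alg A \<Longrightarrow> linear_on (free_alg A) cscale (\<lambda>x. x \<diamondop> y)"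
  and linear_cup_right: "x \<in> free_alg A \<Longrightarrow> linear_on (free_alg A) cscale (\<lambda>y. x \<diamondop> y)"
  using bilinear_cup by (simp_all add: bilinear_on_def)

lemma cup_zero:
  assumes "x \<in> free_alg A"
  shows "0 \<diamondop> x = 0" "x \<diamondop> 0 = 0"
  using linear_on_sum[OF linear_cup_left[OF assms] subspace_free_alg _ cfun.vector_space_axioms, of "{}"]
    linear_on_sum[OF linear_cup_right[OF assms] subspace_free_alg _ cfun.vector_space_axioms, of "{}"]
  by auto

lemma conv_unit_left:
  assumes "\<And>w. w \<in> lists A \<Longrightarrow> f w \<in> free_alg A" "w \<in> lists A"
  shows "conv conv_unit f w = f w"
proof -
  have "conv conv_unit f w = (\<Sum>(u, v)\<in>{(u, v). u @ v = w}. if u = [] then f v else 0)"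
    unfolding conv_def
  proof (rule sum.cong[OF refl])
    fix p assume "p \<in> {(u, v). u @ v = w}"
    then show "(case p of (u, v) \<Rightarrow> conv_unit u \<diamondop> f v) = (case p of (u, v) \<Rightarrow> if u = [] then f v else 0)"
      by (rule splits_cases[OF _ assms(2)]) (simp add: conv_unit_def cup_unit cup_zero assms(1))
  qed
  then show ?thesis by (simp only: sum_splits_Nil_left)
qed

lemma conv_unit_right:
  assumes "\<And>w. w \<in> lists A \<Longrightarrow> f w \<in> free_alg A" "w \<in> lists A"
  shows "conv f conv_unit w = f w"
proof -
  have "conv f conv_unit w = (\<Sum>(u, v)\<in>{(u, v). u @ v = w}. if v = [] then f u else 0)"
    unfolding conv_def
  proof (rule sum.cong[OF refl])
    fix p assume "p \<in> {(u, v). u @ v = w}"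
    then show "(case p of (u, v) \<Rightarrow> f u \<diamondop> conv_unit v) = (case p of (u, v) \<Rightarrow> if v = [] then f u else 0)"
      by (rule splits_cases[OF _ assms(2)]) (simp add: conv_unit_def cup_unit cup_zero assms(1))
  qed
  then show ?thesis by (simp only: sum_splits_Nil_right)
qed

text \<open>Linearity of the product in each argument moves the inner sum out;
  \<open>cup_assoc\<close> and \<open>sum_splits_assoc\<close> then match the terms.\<close>

lemma conv_assoc:
  assumes "\<And>w. w \<in> lists A \<Longrightarrow> f w \<in> free_alg A" "\<And>w. w \<in> lists A \<Longrightarrow> g w \<in> free_alg A"
    "\<And>w. w \<in> lists A \<Longrightarrow> h w \<in> free_alg A" "w \<in> lists A"
  shows "conv (conv f g) h w = conv f (conv g h) w"
proof -
  have "conv (conv f g) h w = (\<Sum>(p, z)\<in>{(p, z). p @ z = w}. \<Sum>(x, y)\<in>{(x, y). x @ y = p}. f x \<diamondop> g y \<diamondop> h z)"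
    unfolding conv_def[of "conv f g"]
  proof (rule sum.cong[OF refl], clarify)
    fix p z assume w: "w = p @ z"
    have pz: "p \<in> lists A" "z \<in> lists A" using assms(4) unfolding w by simp_all
    have "conv f g p \<diamondop> h z = (\<Sum>t\<in>{(x, y). x @ y = p}. (case t of (x, y) \<Rightarrow> f x \<diamondop> g y) \<diamondop> h z)"
      unfolding conv_def
      by (rule linear_on_sum[OF linear_cup_left[OF assms(3)[OF pz(2)]] subspace_free_alg _ cfun.vector_space_axioms])
        (erule splits_cases[OF _ pz(1)], simp only: prod.case cup_in assms(1,2))
    then show "conv f g p \<diamondop> h z = (\<Sum>(x, y)\<in>{(x, y). x @ y = p}. f x \<diamondop> g y \<diamondop> h z)"
      by (simp add: case_prod_unfold)
  qed
  also have "\<dots> = (\<Sum>(x, q)\<in>{(x, q). x @ q = w}. \<Sum>(y, z)\<in>{(y, z). y @ z = q}. f x \<diamondop> g y \<diamondop> h z)"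
    by (rule sum_splits_assoc)
  also have "\<dots> = conv f (conv g h) w"
    unfolding conv_def[of f]
  proof (rule sum.cong[OF refl], clarify)
    fix x q assume w: "w = x @ q"
    have xq: "x \<in> lists A" "q \<in> lists A" using assms(4) unfolding w by simp_all
    have "f x \<diamondop> conv g h q = (\<Sum>t\<in>{(y, z). y @ z = q}. f x \<diamondop> (case t of (y, z) \<Rightarrow> g y \<diamondop> h z))"
      unfolding conv_def
      by (rule linear_on_sum[OF linear_cup_right[OF assms(1)[OF xq(1)]] subspace_free_alg _ cfun.vector_space_axioms])
        (erule splits_cases[OF _ xq(2)], simp only: prod.case cup_in assms(2,3))
    also have "\<dots> = (\<Sum>(y, z)\<in>{(y, z). y @ z = q}. f x \<diamondop> g y \<diamondop> h z)"
      by (rule sum.cong[OF refl], erule splits_cases[OF _ xq(2)])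
        (simp only: prod.case cup_assoc assms(1-3) xq(1))
    finally show "(\<Sum>(y, z)\<in>{(y, z). y @ z = q}. f x \<diamondop> g y \<diamondop> h z) = f x \<diamondop> conv g h q" ..
  qed
  finally show ?thesis .
qed

text \<open>Solves \<open>conv l f = conv_unit\<close> for \<open>l w\<close>: when
  \<open>f [] = word []\<close>, the factorization with empty suffix contributes \<open>l w\<close>
  itself, and the others involve only shorter prefixes.\<close>

function left_inverse :: "('a list \<Rightarrow> 'a list \<Rightarrow> complex) \<Rightarrow> 'a list \<Rightarrow> 'a list \<Rightarrow> complex" where
  "left_inverse f w = (if w = [] then word []
     else - (\<Sum>p\<in>{(u, v). u @ v = w \<and> v \<noteq> []}. left_inverse f (fst p) \<diamondop> f (snd p)))"
  by auto
termination by (relation "measure (\<lambda>(f, w). length w)") auto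

declare left_inverse.simps [simp del]

lemma left_inverse_Nil: "left_inverse f [] = word []"
  by (simp add: left_inverse.simps)

lemma left_inverse_in:
  assumes "\<And>w. w \<in> lists A \<Longrightarrow> f w \<in> free_alg A" "w \<in> lists A"
  shows "left_inverse f w \<in> free_alg A"
  using assms(2)
proof (induction w rule: length_induct)
  case (1 w)
  show ?case
  proof (cases "w = []")
    case False
    have "left_inverse f (fst p) \<diamondop> f (snd p) \<in> free_alg A" if "p \<in> {(u, v). u @ v = w \<and> v \<noteq> []}" for p
      using that 1 assms(1) by (auto intro!: cup_in)
    then show ?thesis
      using False
      by (subst left_inverse.simps)
        (auto intro!: cfun.subspace_neg cfun.subspace_sum subspace_free_alg)
  qed (simp add: left_inverse_Nil unit_in)
qed

lemma conv_left_inverse: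
  assumes f: "\<And>w. w \<in> lists A \<Longrightarrow> f w \<in> free_alg A" "f [] = word []" and w: "w \<in> lists A"
  shows "conv (left_inverse f) f w = conv_unit w"
proof (cases "w = []")
  case True
  then show ?thesis
    by (simp add: conv_def splits_Nil left_inverse_Nil f(2) cup_unit unit_in conv_unit_def)
next
  case False
  have S: "{(u, v). u @ v = w} = insert (w, []) {(u, v). u @ v = w \<and> v \<noteq> []}" by auto
  have fin: "finite {(u, v). u @ v = w \<and> v \<noteq> []}"
    by (rule finite_subset[OF _ finite_splits[of w]]) auto
  have "conv (left_inverse f) f w
      = (\<Sum>p\<in>insert (w, []) {(u, v). u @ v = w \<and> v \<noteq> []}. left_inverse f (fst p) \<diamondop> f (snd p))"
    unfolding conv_def S by (rule sum.cong) auto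
  also have "\<dots> = left_inverse f w \<diamondop> f []
      + (\<Sum>p\<in>{(u, v). u @ v = w \<and> v \<noteq> []}. left_inverse f (fst p) \<diamondop> f (snd p))"
    using fin by simp
  also have "left_inverse f w \<diamondop> f [] = left_inverse f w"
    unfolding f(2) by (rule cup_unit(2)[OF left_inverse_in[OF f(1) w]])
  finally show ?thesis
    using False by (subst (asm) left_inverse.simps) (simp add: conv_unit_def)
qed

text \<open>A left inverse \<open>l\<close> of \<open>f\<close> has itself a left inverse, which must be \<open>f\<close> by associativity.\<close>

lemma conv_right_inverse:
  assumes f: "\<And>w. w \<in> lists A \<Longrightarrow> f w \<in> free_alg A" "f [] = word []" and w: "w \<in> lists A"
  shows "conv f (left_inverse f) w = conv_unit w"
proof -
  let ?l = "left_inverse f" and ?k = "left_inverse (left_inverse f)"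
  note l = left_inverse_in[of f, OF f(1)] left_inverse_Nil[of f]
  note k = left_inverse_in[of ?l, OF l(1)]
  have "?k v = f v" if v: "v \<in> lists A" for v
  proof -
    have "?k v = conv ?k conv_unit v"
      by (rule conv_unit_right[OF k v, symmetric])
    also have "\<dots> = conv ?k (conv ?l f) v"
      by (rule conv_cong[OF refl conv_left_inverse[of f, OF f, symmetric] v])
    also have "\<dots> = conv (conv ?k ?l) f v"
      by (rule conv_assoc[OF k l(1) f(1) v, symmetric])
    also have "\<dots> = conv conv_unit f v"
      by (rule conv_cong[OF conv_left_inverse[of ?l, OF l] refl v])
    also have "\<dots> = f v"
      by (rule conv_unit_left[OF f(1) v])
    finally show ?thesis .
  qed
  then have "conv f ?l w = conv ?k ?l w"
    using w by (intro conv_cong) auto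
  also have "\<dots> = conv_unit w"
    by (rule conv_left_inverse[of ?l, OF l w])
  finally show ?thesis .
qed

lemma is_hopf_algebra_cup: "is_hopf_algebra (cup_bialg A \<Delta>)"
proof -
  let ?V = "free_alg A"
  \<comment> \<open>The identity map is encoded by \<open>word\<close>.\<close>
  define S where "S = extend_linearly (left_inverse word)"
  have lin: "linear_on ?V cscale S"
    unfolding S_def by (rule linear_on_extend_linearly)
  note L = left_inverse_in[OF word_in_free_alg]
  have S_in: "S x \<in> ?V" if x: "x \<in> ?V" for x
    unfolding S_def extend_linearly_def
    by (intro cfun.subspace_sum cfun.subspace_scale subspace_free_alg L)
      (use x in \<open>auto simp: free_alg_def\<close>)
  have S_word: "S (word w) = left_inverse word w" for w
    unfolding S_def by (rule extend_linearly_word)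
  have bil: "bilinear_on ?V ?V cscale (\<lambda>a b. S a \<diamondop> b)" "bilinear_on ?V ?V cscale (\<lambda>a b. a \<diamondop> S b)"
    using bilinear_cup lin S_in by (simp_all add: bilinear_on_def linear_on_def)
  have unit: "(\<Sum>w\<in>words N. cscale (x w) (conv_unit w)) = cscale (x []) (word [])" for x N
  proof -
    have "(\<Sum>w\<in>words N. cscale (x w) (conv_unit w)) = (\<Sum>w\<in>words N. if w = [] then cscale (x w) (word []) else 0)"
      by (intro sum.cong refl) (auto simp: conv_unit_def)
    then show ?thesis by simp
  qed
  have "tensor_lift cscale ?V ?V (\<lambda>a b. S a \<diamondop> b) (deconc x) = cscale (x []) (word []) \<and>
      tensor_lift cscale ?V ?V (\<lambda>a b. a \<diamondop> S b) (deconc x) = cscale (x []) (word [])"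
    if x: "x \<in> ?V" for x
  proof
    obtain N where N: "supp x \<subseteq> words N" using supp_subset_words[OF x] .
    show "tensor_lift cscale ?V ?V (\<lambda>a b. S a \<diamondop> b) (deconc x) = cscale (x []) (word [])"
      unfolding tensor_lift_deconc[OF bil(1) N] S_word conv_def[symmetric] unit[of x N, symmetric]
      using conv_left_inverse[of word, OF word_in_free_alg refl words_listsD] by (intro sum.cong refl) simp
    show "tensor_lift cscale ?V ?V (\<lambda>a b. a \<diamondop> S b) (deconc x) = cscale (x []) (word [])"
      unfolding tensor_lift_deconc[OF bil(2) N] S_word conv_def[symmetric] unit[of x N, symmetric]
      using conv_right_inverse[of word, OF word_in_free_alg refl words_listsD] by (intro sum.cong refl) simp
  qed
  then have "is_antipode (cup_bialg A \<Delta>) S"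
    unfolding is_antipode_def by (simp add: cup_bialg_def lin S_in)
  then show ?thesis
    unfolding is_hopf_algebra_def using is_bialgebra_cup by blast
qed

subsection \<open>The graded dual\<close>

text \<open>Sends x to the functional (x, -), set to 0 off the free algebra because the elements of
  \<open>graded_dual\<close> are extended by 0 there.\<close>

definition dual_map :: "('a list \<Rightarrow> complex) \<Rightarrow> ('a list \<Rightarrow> complex) \<Rightarrow> complex" where
  "dual_map x y = (if y \<in> free_alg A then pairing x y else 0)"

lemma dual_map_left:
  assumes "supp x \<subseteq> words N" "y \<in> free_alg A"
  shows "dual_map x y = (\<Sum>w\<in>words N. x w * y w)"
  unfolding dual_map_def pairing_def using assms
  by (simp, intro sum.mono_neutral_left) auto

text \<open>Either argument may supply the finite range: x when its functional is examined as in
  \<open>dual_map_left\<close>, and y when x varies or is a product.\<close>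

lemma dual_map_right:
  assumes "x \<in> free_alg A" "supp y \<subseteq> words N"
  shows "dual_map x y = (\<Sum>w\<in>words N. x w * y w)"
  unfolding dual_map_def using assms free_alg_wordsI[OF assms(2)]
  by (simp add: free_alg_iff pairing_eq_sum)

lemma dual_map_word:
  assumes "x \<in> free_alg A"
  shows "dual_map x (word w) = x w"
proof (cases "w \<in> lists A")
  case True
  have "supp (word w) \<subseteq> words (wdeg w)"
    using True by (auto simp: word_apply words_def split: if_splits)
  from dual_map_right[OF assms this] have "dual_map x (word w) = (\<Sum>v\<in>words (wdeg w). if v = w then x v else 0)"
    by (simp add: word_apply if_distrib cong: if_cong)
  then show ?thesis using self_in_words[OF True order_refl] by simp
next
  case False
  then have "word w \<notin> free_alg A" "x w = 0"
    using assms by (auto simp: free_alg_def word_def)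
  then show ?thesis by (simp add: dual_map_def)
qed

lemma linear_dual_map: "linear_on (free_alg A) cscale dual_map"
proof -
  have "dual_map (x + y) z = dual_map x z + dual_map y z" "dual_map (cscale c x) z = c * dual_map x z"
    if "x \<in> free_alg A" "y \<in> free_alg A" for x y z c
  proof -
    show "dual_map (x + y) z = dual_map x z + dual_map y z"
    proof (cases "z \<in> free_alg A")
      case True
      then obtain N where N: "supp z \<subseteq> words N" using supp_subset_words by blast
      show ?thesis
        unfolding dual_map_right[OF cfun.subspace_add[OF subspace_free_alg that] N]
          dual_map_right[OF that(1) N] dual_map_right[OF that(2) N]
        by (simp add: sum.distrib algebra_simps)
    qed (simp add: dual_map_def)
    show "dual_map (cscale c x) z = c * dual_map x z"
    proof (cases "z \<in> free_alg A")
      case True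
      then obtain N where N: "supp z \<subseteq> words N" using supp_subset_words by blast
      show ?thesis
        unfolding dual_map_right[OF cfun.subspace_scale[OF subspace_free_alg that(1)] N]
          dual_map_right[OF that(1) N]
        by (simp add: cscale_apply sum_distrib_left mult_ac)
    qed (simp add: dual_map_def)
  qed
  then show ?thesis by (auto simp: linear_on_def fun_eq_iff cscale_apply)
qed

lemma linear_dual_map_right:
  assumes "x \<in> free_alg A"
  shows "linear_on (free_alg A) (*) (dual_map x)"
proof -
  obtain N where N: "supp x \<subseteq> words N" using supp_subset_words[OF assms] .
  show ?thesis
    by (simp add: linear_on_def dual_map_left[OF N] cfun.subspace_add[OF subspace_free_alg]
        cfun.subspace_scale[OF subspace_free_alg] cscale_apply sum.distrib sum_distrib_left algebra_simps)
qed

abbreviation dual :: "('a list \<Rightarrow> complex) bialg" where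
  "dual \<equiv> graded_dual (conc_bialg A \<Delta> \<epsilon>) (component A deg)"

lemma carr_dual: "f \<in> carr dual \<longleftrightarrow> linear_on (free_alg A) (*) f \<and> (\<forall>x. x \<notin> free_alg A \<longrightarrow> f x = 0) \<and>
    finite {n. \<exists>x\<in>component A deg n. f x \<noteq> 0}"
  by (simp add: graded_dual_def conc_bialg_def)

lemma dual_map_in_carr:
  assumes "x \<in> free_alg A"
  shows "dual_map x \<in> carr dual"
proof -
  obtain N where N: "supp x \<subseteq> words N" using supp_subset_words[OF assms] .
  \<comment> \<open>Components of degree above N are orthogonal to x.\<close>
  have "{n. \<exists>y\<in>component A deg n. dual_map x y \<noteq> 0} \<subseteq> {..N}"
  proof
    fix n assume "n \<in> {n. \<exists>y\<in>component A deg n. dual_map x y \<noteq> 0}"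
    then obtain y where y: "y \<in> component A deg n" "dual_map x y \<noteq> 0" by blast
    then have "(\<Sum>w\<in>words N. x w * y w) \<noteq> 0"
      using dual_map_left[OF N, of y] by (simp add: component_def)
    then obtain w where "w \<in> words N" "x w * y w \<noteq> 0" by (meson sum.neutral)
    then show "n \<in> {..N}" using y(1) by (auto simp: component_def words_def)
  qed
  then have "finite {n. \<exists>y\<in>component A deg n. dual_map x y \<noteq> 0}"
    by (rule finite_subset) simp
  then show ?thesis
    using linear_dual_map_right[OF assms] by (simp add: carr_dual dual_map_def)
qed

text \<open>The coefficients of the preimage are the values of f on words. They are finitely many
  because f vanishes on all but finitely many components and each degree contains finitely many
  words.\<close>

lemma dual_map_surj:
  assumes "f \<in> carr dual"
  obtains x where "x \<in> free_alg A" "dual_map x = f"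
proof -
  define x where "x w = (if w \<in> lists A then f (word w) else 0)" for w
  from assms have f: "linear_on (free_alg A) (*) f" "\<And>x. x \<notin> free_alg A \<Longrightarrow> f x = 0"
    and fin: "finite {n. \<exists>x\<in>component A deg n. f x \<noteq> 0}"
    by (simp_all add: carr_dual)
  obtain N where N: "\<And>n. n \<in> {n. \<exists>x\<in>component A deg n. f x \<noteq> 0} \<Longrightarrow> n \<le> N"
    using fin by (meson finite_nat_set_iff_bounded_le)
  have s: "supp x \<subseteq> words N"
  proof
    fix w assume "w \<in> supp x"
    then have w: "w \<in> lists A" "f (word w) \<noteq> 0" by (simp_all add: x_def split: if_splits)
    then have "word w \<in> component A deg (wdeg w)"
      using word_in_free_alg by (auto simp: component_def word_def)
    then show "w \<in> words N" using N[of "wdeg w"] w by (auto simp: words_def)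
  qed
  have x: "x \<in> free_alg A" by (rule free_alg_wordsI[OF s])
  have "dual_map x y = f y" for y
  proof (cases "y \<in> free_alg A")
    case True
    then obtain M where M: "supp y \<subseteq> words M" using supp_subset_words by blast
    have "f y = (\<Sum>w\<in>words M. y w * f (word w))"
      by (rule linear_on_free_alg[OF vector_space_complex f(1) finite_words words_subset M])
    also have "\<dots> = (\<Sum>w\<in>words M. x w * y w)"
      by (rule sum.cong) (simp_all add: x_def words_def)
    finally show ?thesis using dual_map_right[OF x M] by simp
  qed (simp add: dual_map_def f(2))
  with x show ?thesis by (intro that[of x]) auto
qed

text \<open>Both sides are the triple sum of
  \<open>x u * y v * \<Delta> (word w) (u, v) * z w\<close>; they differ in whether w or (u, v) is
  summed first.\<close>

lemma dual_map_cup: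
  assumes x: "x \<in> free_alg A" and y: "y \<in> free_alg A"
  shows "dual_map (x \<diamondop> y) = mlt dual (dual_map x) (dual_map y)"
proof
  fix z
  show "dual_map (x \<diamondop> y) z = mlt dual (dual_map x) (dual_map y) z"
  proof (cases "z \<in> free_alg A")
    case True
    then obtain N where N: "supp z \<subseteq> words N" using supp_subset_words by blast
    have "bilinear_on (free_alg A) (free_alg A) (*) (\<lambda>a b. dual_map x a * dual_map y b)"
      using linear_dual_map_right[OF x] linear_dual_map_right[OF y]
      by (auto simp: bilinear_on_def linear_on_def algebra_simps)
    from tensor_lift_words[OF vector_space_complex this supp_comult_free_alg[OF N]] True
    have "mlt dual (dual_map x) (dual_map y) z = (\<Sum>u\<in>words N. \<Sum>v\<in>words N. \<Delta> z (u, v) * (x u * y v))"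
      by (simp add: graded_dual_def conc_bialg_def dual_map_word[OF x] dual_map_word[OF y])
    also have "\<dots> = (\<Sum>u\<in>words N. \<Sum>v\<in>words N. \<Sum>w\<in>words N. x u * y v * \<Delta> (word w) (u, v) * z w)"
      by (simp add: comult_eq_sum[OF N] sum_distrib_left sum_distrib_right mult_ac)
    also have "\<dots> = (\<Sum>w\<in>words N. \<Sum>u\<in>words N. \<Sum>v\<in>words N. x u * y v * \<Delta> (word w) (u, v) * z w)"
      by (rule sum_rotate[symmetric])
    also have "\<dots> = (\<Sum>w\<in>words N. (x \<diamondop> y) w * z w)"
      by (rule sum.cong[OF refl]) (simp add: cup_eq_sum[OF x y] sum_distrib_right)
    also have "\<dots> = dual_map (x \<diamondop> y) z"
      by (rule dual_map_right[OF cup_in[OF x y] N, symmetric])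
    finally show ?thesis ..
  qed (simp add: dual_map_def graded_dual_def conc_bialg_def)
qed

lemma dual_map_deconc:
  assumes x: "x \<in> free_alg A"
  shows "tensor_map (free_alg A) (free_alg A) dual_map dual_map (deconc x) = comlt dual (dual_map x)"
proof
  fix p :: "('a list \<Rightarrow> complex) \<times> ('a list \<Rightarrow> complex)"
  obtain y z where p: "p = (y, z)" by (cases p)
  obtain N where N: "supp x \<subseteq> words N" using supp_subset_words[OF x] .
  \<comment> \<open>Stated for every M \<ge> N so that the truncation can be enlarged to cover y and
    z as well.\<close>
  have L: "tensor_map (free_alg A) (free_alg A) dual_map dual_map (deconc x) p
      = (\<Sum>u\<in>words M. \<Sum>v\<in>words M. x (u @ v) * (dual_map (word u) y * dual_map (word v) z))" if "N \<le> M" for M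
  proof -
    have s: "supp x \<subseteq> words M" using N words_mono[OF that] by blast
    show ?thesis
      unfolding p tensor_map_words[OF linear_dual_map linear_dual_map supp_deconc[OF s]] deconc_words[OF s] ..
  qed
  show "tensor_map (free_alg A) (free_alg A) dual_map dual_map (deconc x) p = comlt dual (dual_map x) p"
  proof (cases "y \<in> free_alg A \<and> z \<in> free_alg A")
    case True
    then obtain K K' where "supp y \<subseteq> words K" "supp z \<subseteq> words K'"
      using supp_subset_words by metis
    then have M: "supp y \<subseteq> words (N + K + K')" "supp z \<subseteq> words (N + K + K')" "N \<le> N + K + K'"
      using words_mono[of K "N + K + K'"] words_mono[of K' "N + K + K'"] by auto
    define W where "W = words (N + K + K')"
    have sx: "supp x \<subseteq> W" using N words_mono[OF M(3)] unfolding W_def by blast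
    have dm: "dual_map (word u) y = y u" if "u \<in> W" "y \<in> free_alg A" for u y
    proof -
      have "supp (word u) \<subseteq> words (N + K + K')"
        using that by (auto simp: word_apply W_def split: if_splits)
      from dual_map_left[OF this that(2)] that(1) show ?thesis
        by (simp add: word_apply W_def if_distrib[of "\<lambda>c. c * _"] cong: if_cong)
    qed
    have "comlt dual (dual_map x) p = dual_map x (conc y z)"
      using True by (simp add: p graded_dual_def conc_bialg_def)
    also have "\<dots> = (\<Sum>w\<in>W. x w * conc y z w)"
      unfolding W_def using True by (intro dual_map_left[OF sx[unfolded W_def]] conc_in_free_alg) auto
    also have "\<dots> = (\<Sum>w\<in>W. \<Sum>u\<in>W. \<Sum>v\<in>W. if w = u @ v then x w * (y u * z v) else 0)"
      unfolding conc_apply[OF finite_words M(1,2), folded W_def] sum_distrib_left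
      by (intro sum.cong refl) auto
    also have "\<dots> = (\<Sum>u\<in>W. \<Sum>v\<in>W. \<Sum>w\<in>W. if w = u @ v then x w * (y u * z v) else 0)"
      by (rule sum_rotate)
    also have "\<dots> = (\<Sum>u\<in>W. \<Sum>v\<in>W. x (u @ v) * (y u * z v))"
      using sx by (intro sum.cong refl) (auto simp: W_def)
    also have "\<dots> = (\<Sum>u\<in>W. \<Sum>v\<in>W. x (u @ v) * (dual_map (word u) y * dual_map (word v) z))"
      using True by (intro sum.cong refl) (simp add: dm)
    finally show ?thesis using L[OF M(3)] unfolding W_def by simp
  next
    \<comment> \<open>Functions on pairs are compared at all arguments, and off the free algebra
      both are 0.\<close>
    case False
    have "comlt dual (dual_map x) p = 0"
      using False by (auto simp: p graded_dual_def conc_bialg_def)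
    moreover have "dual_map (word u) y * dual_map (word v) z = 0" for u v
      using False by (auto simp: dual_map_def)
    then have "tensor_map (free_alg A) (free_alg A) dual_map dual_map (deconc x) p = 0"
      unfolding L[OF order_refl] by (simp only: mult_zero_right sum.neutral_const)
    ultimately show ?thesis by simp
  qed
qed

lemma is_bialgebra_iso_dual_map: "is_bialgebra_iso (cup_bialg A \<Delta>) dual dual_map"
proof -
  have "bij_betw dual_map (free_alg A) (carr dual)"
    unfolding bij_betw_def
  proof
    show "inj_on dual_map (free_alg A)"
    proof (rule inj_onI)
      fix x y assume "x \<in> free_alg A" "y \<in> free_alg A" "dual_map x = dual_map y"
      then have "x w = y w" for w using dual_map_word by metis
      then show "x = y" by blast
    qed
    show "dual_map ` free_alg A = carr dual"
      using dual_map_in_carr by (auto elim: dual_map_surj)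
  qed
  \<comment> \<open>The empty word yields the functional taking the coefficient of 1, which is the
    counit by \<open>counit_eq\<close>.\<close>
  moreover have "dual_map (word []) = unt dual"
  proof
    fix z
    have "supp (word []) \<subseteq> words 0" by (auto simp: word_apply split: if_splits)
    from dual_map_left[OF this, of z] show "dual_map (word []) z = unt dual z"
      by (cases "z \<in> free_alg A")
        (simp_all add: graded_dual_def conc_bialg_def counit_eq dual_map_def word_apply
          if_distrib[of "\<lambda>c. c * _"] cong: if_cong)
  qed
  moreover have "counit dual (dual_map x) = x []" if "x \<in> free_alg A" for x
    using dual_map_word[OF that, of "[]"] by (simp add: graded_dual_def conc_bialg_def)
  ultimately show ?thesis
    unfolding is_bialgebra_iso_def
    by (simp add: cup_bialg_def linear_dual_map dual_map_cup dual_map_deconc)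
qed

subsection \<open>Restriction to a subalphabet\<close>

text \<open>Induction by \<open>comult_append\<close>: a nonzero coefficient has a nonzero term,
  whose pieces are words over A' by compatibility for the first letter and by induction for the
  rest.\<close>

lemma comult_word_restrict:
  assumes "\<forall>a\<in>A'. \<Delta> (word [a]) \<in> tensor_space (free_alg A') (free_alg A')" "A' \<subseteq> A"
    and "w \<in> lists A'" "\<Delta> (word w) (u1, u2) \<noteq> 0"
  shows "u1 \<in> lists A' \<and> u2 \<in> lists A'"
  using assms(3,4)
proof (induction w arbitrary: u1 u2 rule: list.induct)
  case Nil
  then show ?case by (simp add: comult_Nil split: if_splits)
next
  case (Cons a w u1 u2)
  have "a \<in> A'" "w \<in> lists A'" using Cons.prems by simp_all
  moreover from this have A: "[a] \<in> lists A" "w \<in> lists A"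
    using assms(2) lists_mono[OF assms(2)] by auto
  have "(\<Sum>(p1, v1, p2, v2)\<in>{(p1, v1, p2, v2). u1 = p1 @ v1 \<and> u2 = p2 @ v2}.
      \<Delta> (word [a]) (p1, p2) * \<Delta> (word w) (v1, v2)) \<noteq> 0"
    using Cons.prems(2) comult_append[OF A, of u1 u2] by simp
  then obtain p where p: "p \<in> {(p1, v1, p2, v2). u1 = p1 @ v1 \<and> u2 = p2 @ v2}"
    "(case p of (p1, v1, p2, v2) \<Rightarrow> \<Delta> (word [a]) (p1, p2) * \<Delta> (word w) (v1, v2)) \<noteq> 0"
    by (meson sum.neutral)
  obtain p1 v1 p2 v2 where q: "p = (p1, v1, p2, v2)" by (cases p)
  from p have "u1 = p1 @ v1" "u2 = p2 @ v2" "\<Delta> (word [a]) (p1, p2) \<noteq> 0" "\<Delta> (word w) (v1, v2) \<noteq> 0"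
    by (simp_all add: q)
  moreover have "p1 \<in> lists A' \<and> p2 \<in> lists A'"
  proof -
    have "supp (\<Delta> (word [a])) \<subseteq> lists A' \<times> lists A'"
      using assms(1) \<open>a \<in> A'\<close> by (simp add: tensor_space_free_alg)
    then show ?thesis using \<open>\<Delta> (word [a]) (p1, p2) \<noteq> 0\<close> by (simp add: subset_iff)
  qed
  ultimately show ?case using Cons.IH[of v1 v2] by simp
qed

text \<open>The operations stay the same; what changes with the alphabet is the carrier and the
  lifts taken over it. So \<Delta> has to preserve the smaller tensor space, and each lift over A'
  has to agree there with the one over A.\<close>

lemma graded_word_bialgebra_restrict:
  assumes compat: "\<forall>a\<in>A'. \<Delta> (word [a]) \<in> tensor_space (free_alg A') (free_alg A')" and sub: "A' \<subseteq> A"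
  shows "graded_word_bialgebra A' deg \<Delta> \<epsilon>"
proof
  let ?V = "free_alg A" and ?V' = "free_alg A'" and ?H = "conc_bialg A \<Delta> \<epsilon>" and ?H' = "conc_bialg A' \<Delta> \<epsilon>"
  have V: "x \<in> ?V" if "x \<in> ?V'" for x using free_alg_mono[OF sub] that by blast
  have L: "w \<in> lists A" if "w \<in> lists A'" for w using lists_mono[OF sub] that by blast
  have "finite {a \<in> A'. deg a = n}" for n
    by (rule finite_subset[of _ "{a \<in> A. deg a = n}"]) (use alphabet sub in \<open>auto simp: graded_alphabet_def\<close>)
  then show "graded_alphabet A' deg"
    using alphabet sub by (auto simp: graded_alphabet_def)
  show "(\<Sum>a\<leftarrow>u. deg a) + (\<Sum>a\<leftarrow>v. deg a) = (\<Sum>a\<leftarrow>w. deg a)"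
    if "w \<in> lists A'" "\<Delta> (word w) (u, v) \<noteq> 0" for w u v
    using homogeneous[OF L[OF that(1)] that(2)] .
  show "\<epsilon> (word w) = (if w = [] then 1 else 0)" if "w \<in> lists A'" for w
    using counit_word[OF L[OF that]] .
  have T: "\<Delta> x \<in> tensor_space ?V' ?V'" if x: "x \<in> ?V'" for x
  proof -
    obtain N where N: "supp x \<subseteq> words N" using supp_subset_words[OF V[OF x]] .
    have "p \<in> lists A' \<times> lists A'" if "p \<in> supp (\<Delta> x)" for p
    proof -
      obtain u v where p: "p = (u, v)" by (cases p)
      have "(\<Sum>w\<in>words N. x w * \<Delta> (word w) p) \<noteq> 0"
        using that comult_eq_sum[OF N, of p] by simp
      then obtain w where w: "x w * \<Delta> (word w) p \<noteq> 0"
        by (meson sum.neutral)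
      then have "w \<in> supp x" "\<Delta> (word w) (u, v) \<noteq> 0" by (simp_all add: p)
      moreover from this have "w \<in> lists A'" using x unfolding free_alg_iff by blast
      ultimately show ?thesis using comult_word_restrict[OF compat sub, of w u v] by (simp add: p)
    qed
    moreover have "finite (supp (\<Delta> x))"
      by (rule finite_subset[OF supp_comult_free_alg[OF N]]) simp
    ultimately show ?thesis by (auto simp: tensor_space_free_alg)
  qed
  have conc_bil: "bilinear_on ?V' ?V' cscale conc"
    by (rule bilinear_on_subset[OF bilinear_conc free_alg_mono[OF sub] free_alg_mono[OF sub]])
  note Alg = bialgebra[unfolded is_bialgebra_def is_algebra_def conc_bialg_def, simplified]
  have alg: "is_algebra ?H'"
    unfolding is_algebra_def using Alg V
    by (simp add: conc_bialg_def subspace_free_alg conc_in_free_alg conc_bil unit_in word_in_free_alg)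
  have lin: "linear_on ?V' cscale \<Delta>" "linear_on ?V' (*) \<epsilon>"
    by (rule linear_on_subset[OF linear_comult free_alg_mono[OF sub]],
        rule linear_on_subset[OF linear_counit free_alg_mono[OF sub]])
  have map: "tensor_map ?V' ?V' \<phi> \<psi> t = tensor_map ?V ?V \<phi> \<psi> t"
    if "linear_on ?V cscale \<phi>" "linear_on ?V cscale \<psi>" "t \<in> tensor_space ?V' ?V'"
    for t and \<phi> :: "_ \<Rightarrow> 'y \<Rightarrow> complex" and \<psi> :: "_ \<Rightarrow> 'z \<Rightarrow> complex"
    unfolding tensor_map_def
    by (rule tensor_lift_restrict[OF cfun.vector_space_axioms bilinear_on_tens[OF that(1,2)] sub that(3)])
  have lift: "tensor_lift cscale ?V' ?V' B t = tensor_lift cscale ?V ?V B t"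
    if "bilinear_on ?V ?V cscale B" "t \<in> tensor_space ?V' ?V'"
    for t and B :: "_ \<Rightarrow> _ \<Rightarrow> 'a list \<Rightarrow> complex"
    by (rule tensor_lift_restrict[OF cfun.vector_space_axioms that(1) sub that(2)])
  have bil: "bilinear_on ?V ?V cscale (\<lambda>a. cscale (\<epsilon> a))" "bilinear_on ?V ?V cscale (\<lambda>a b. cscale (\<epsilon> b) a)"
    using linear_counit by (auto simp: bilinear_on_def linear_on_def cscale_def fun_eq_iff algebra_simps)
  have coalg: "is_coalgebra ?H'"
    unfolding is_coalgebra_def using coalgebra[unfolded is_coalgebra_def]
    by (simp add: conc_bialg_def subspace_free_alg T lin V lift[OF bil(1)] lift[OF bil(2)]
        map[OF linear_comult linear_id] map[OF linear_id linear_comult])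
  have mult: "tensor_mult ?H' s t = tensor_mult ?H s t"
    if st: "s \<in> tensor_space ?V' ?V'" "t \<in> tensor_space ?V' ?V'" for s t
  proof
    fix p :: "'a list \<times> 'a list"
    obtain S1 S2 where S: "finite S1" "S1 \<subseteq> lists A'" "finite S2" "S2 \<subseteq> lists A'" "supp s \<subseteq> S1 \<times> S2"
      using tensor_space_suppE[OF st(1)] .
    obtain T1 T2 where T: "finite T1" "T1 \<subseteq> lists A'" "finite T2" "T2 \<subseteq> lists A'" "supp t \<subseteq> T1 \<times> T2"
      using tensor_space_suppE[OF st(2)] .
    \<comment> \<open>\<open>tensor_mult_free_alg\<close> covers the support by a square, hence the
      common set for both factors.\<close>
    have S': "finite (S1 \<union> S2)" "S1 \<union> S2 \<subseteq> lists A'" "supp s \<subseteq> (S1 \<union> S2) \<times> (S1 \<union> S2)"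
      using S by blast+
    have T': "finite (T1 \<union> T2)" "T1 \<union> T2 \<subseteq> lists A'" "supp t \<subseteq> (T1 \<union> T2) \<times> (T1 \<union> T2)"
      using T by blast+
    have carr: "carr ?H = ?V" "carr ?H' = ?V'" and mlt: "mlt ?H = conc" "mlt ?H' = conc"
      by (simp_all add: conc_bialg_def)
    note eq = tensor_mult_free_alg[where x = "fst p" and y = "snd p", unfolded prod.collapse]
    have H': "bilinear_on ?V' ?V' cscale (mlt ?H')" and H: "bilinear_on ?V ?V cscale (mlt ?H)"
      by (simp_all only: mlt conc_bil bilinear_conc)
    show "tensor_mult ?H' s t p = tensor_mult ?H s t p"
      unfolding eq[OF carr(2) H' S' T']
        eq[OF carr(1) H S'(1) order_trans[OF S'(2) lists_mono[OF sub]] S'(3)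
          T'(1) order_trans[OF T'(2) lists_mono[OF sub]] T'(3)] mlt ..
  qed
  show "is_bialgebra ?H'"
    unfolding is_bialgebra_def
  proof (intro conjI ballI alg coalg)
    fix x y assume "x \<in> carr ?H'" "y \<in> carr ?H'"
    then have xy: "x \<in> ?V'" "y \<in> ?V'" by (simp_all add: conc_bialg_def)
    have "comlt ?H (mlt ?H x y) = tensor_mult ?H (comlt ?H x) (comlt ?H y)"
      "counit ?H (mlt ?H x y) = counit ?H x * counit ?H y"
      using bialgebra V[OF xy(1)] V[OF xy(2)] by (simp_all add: is_bialgebra_def conc_bialg_def)
    then show "comlt ?H' (mlt ?H' x y) = tensor_mult ?H' (comlt ?H' x) (comlt ?H' y)"
      "counit ?H' (mlt ?H' x y) = counit ?H' x * counit ?H' y"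
      using mult[OF T[OF xy(1)] T[OF xy(2)]] by (simp_all add: conc_bialg_def)
  qed (use bialgebra in \<open>simp_all add: is_bialgebra_def conc_bialg_def\<close>)
qed

end

section \<open>Coordinate form of the grading, and the conclusion\<close>

lemma graded_word_bialgebraI:
  assumes "graded_alphabet A deg"
    and H: "is_graded_hopf_algebra (conc_bialg A \<Delta> \<epsilon>) (component A deg)"
  shows "graded_word_bialgebra A deg \<Delta> \<epsilon>"
proof
  let ?d = "\<lambda>w. \<Sum>a\<leftarrow>w. deg a"
  show "graded_alphabet A deg" by fact
  show bi: "is_bialgebra (conc_bialg A \<Delta> \<epsilon>)"
    using H by (simp only: is_graded_hopf_algebra_def)
  have comp: "word w \<in> component A deg (?d w)" if "w \<in> lists A" for w
    using word_in_free_alg[OF that] by (simp add: component_def word_apply split: if_splits)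
  fix w assume w: "w \<in> lists A"
  show "?d u + ?d v = ?d w" if nz: "\<Delta> (word w) (u, v) \<noteq> 0" for u v
  proof -
    \<comment> \<open>The tensors supported in total degree \<open>?d w\<close>. They form a
      subspace containing each summand of the graded piece, hence also their span.\<close>
    let ?T = "{t. \<forall>u v. t (u, v) \<noteq> (0 :: complex) \<longrightarrow> ?d u + ?d v = ?d w}"
    have sub: "cfun.subspace ?T"
      unfolding cfun.subspace_def by (auto simp: cscale_def) (metis add.right_neutral)+
    have "\<Delta> (word w) \<in> cfun.span (\<Union>i\<le>?d w. tensor_space (component A deg i) (component A deg (?d w - i)))"
      using H comp[OF w] by (simp add: is_graded_hopf_algebra_def conc_bialg_def)
    also have "\<dots> \<subseteq> ?T"
    proof (rule cfun.span_minimal[OF UN_least sub])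
      fix i assume "i \<in> {..?d w}"
      then show "tensor_space (component A deg i) (component A deg (?d w - i)) \<subseteq> ?T"
        unfolding tensor_space_def
        by (intro cfun.span_minimal[OF _ sub]) (auto simp: component_def tens_def)
    qed
    finally show ?thesis using nz by blast
  qed
  show "\<epsilon> (word w) = (if w = [] then 1 else 0)"
  proof (cases "w = []")
    case True
    then show ?thesis using bi by (simp add: is_bialgebra_def conc_bialg_def)
  next
    case False
    then have "?d w > 0"
      using w assms(1) by (cases w) (auto simp: graded_alphabet_def)
    then show ?thesis
      using False H comp[OF w] by (simp add: is_graded_hopf_algebra_def conc_bialg_def)
  qed
qed

theorem lemma4:
  fixes \<Sigma> \<Sigma>' :: "'a set" and deg :: "'a \<Rightarrow> nat"
    and \<Delta> :: "('a list \<Rightarrow> complex) \<Rightarrow> 'a list \<times> 'a list \<Rightarrow> complex"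
    and \<epsilon> :: "('a list \<Rightarrow> complex) \<Rightarrow> complex"
  assumes alphabet: "graded_alphabet \<Sigma> deg"
    and hopf: "is_graded_hopf_algebra (conc_bialg \<Sigma> \<Delta> \<epsilon>) (component \<Sigma> deg)"
    and connected: "is_connected (conc_bialg \<Sigma> \<Delta> \<epsilon>) (component \<Sigma> deg)"
    and cocommutative: "is_cocommutative (conc_bialg \<Sigma> \<Delta> \<epsilon>)"
    and subalphabet: "\<Sigma>' \<subseteq> \<Sigma>"
    and compatible: "\<forall>a\<in>\<Sigma>'. \<Delta> (word [a]) \<in> tensor_space (free_alg \<Sigma>') (free_alg \<Sigma>')"
  shows "is_bialgebra (conc_bialg \<Sigma>' \<Delta> \<epsilon>) \<and>
         is_hopf_algebra (cup_bialg \<Sigma>' \<Delta>) \<and>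
         bialgebra_isomorphic (cup_bialg \<Sigma>' \<Delta>)
           (graded_dual (conc_bialg \<Sigma>' \<Delta> \<epsilon>) (component \<Sigma>' deg)) \<and>
         (\<forall>u1\<in>lists \<Sigma>'. \<forall>u2\<in>lists \<Sigma>'. u1 \<noteq> [] \<or> u2 \<noteq> [] \<longrightarrow>
           cup \<Sigma>' \<Delta> (word u1) (word u2) =
             (\<Sum>(p1, v1, p2, v2)\<in>{(p1, v1, p2, v2).
                  u1 = p1 @ v1 \<and> u2 = p2 @ v2 \<and> (p1 \<noteq> [] \<or> p2 \<noteq> [])}.
                \<Sum>a\<in>{a\<in>\<Sigma>'. pairing (tens (word p1) (word p2)) (\<Delta> (word [a])) \<noteq> 0}.
                  cscale (pairing (tens (word p1) (word p2)) (\<Delta> (word [a])))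
                    (conc (word [a]) (cup \<Sigma>' \<Delta> (word v1) (word v2)))))"
proof -
  interpret H: graded_word_bialgebra \<Sigma> deg \<Delta> \<epsilon>
    by (rule graded_word_bialgebraI[OF alphabet hopf])
  \<comment> \<open>All conclusions are read off from this instance; the instance for \<Sigma> hands
    the axioms down to it.\<close>
  interpret K: graded_word_bialgebra \<Sigma>' deg \<Delta> \<epsilon>
    by (rule H.graded_word_bialgebra_restrict[OF compatible subalphabet])
  show ?thesis
    unfolding pairing_word bialgebra_isomorphic_def
    using K.bialgebra K.is_hopf_algebra_cup K.is_bialgebra_iso_dual_map K.cup_recursion by blast
qed

end
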